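(* Let $C$ be a (smooth complex projective) hyperelliptic curve of genus $g\ge 3$, and let $\mu_{2k}$, $k\ge 0$, denote the even Gaussian maps of the canonical bundle $K_C$. Then for every integer $k$ with $0\le k\le \frac{g-1}{2}$ $$\operatorname{Rank}(\mu_{2k})=2g-(4k+1),\qquad \dim \operatorname{Ker}(\mu_{2k})=\frac{(g-1)(g-2)}{2}-k(2g-2k-3).$$ Moreover, for every integer $k>\lfloor\frac{g-1}{2}\rfloor$ the domain of $\mu_{2k}$ is $0$, hence $\operatorname{Rank}(\mu_{2k})=0$.
   Context: Even Gaussian maps of the canonical bundle: elements of $S^2H^0(C,K_C)$ are viewed as symmetric tensors $Q=\sum_{i,j}a_{ij}\,\eta_i\otimes\eta_j$, $a_{ij}=a_{ji}$, $\eta_i\in H^0(C,K_C)$. The map $\mu_0:S^2H^0(C,K_C)\to H^0(C,K_C^{\otimes 2})$ is multiplication (for hyperelliptic $C$ its image lies in, and equals, the subspace $H^0(C,K_C^{\otimes 2})^+$ invariant under the hyperelliptic involution), and $I_2:=\operatorname{Ker}(\mu_0)$. Inductively, for $k\ge 1$, $\mu_{2k}:\operatorname{Ker}(\mu_{2k-2})\to H^0(C,K_C^{\otimes 2k+2})$ is the restriction to $\operatorname{Ker}(\mu_{2k-2})$ of the restriction-to-the-diagonal map $H^0(C\times C,(K_C\boxtimes K_C)(-2k\Delta))\to H^0(C,K_C^{\otimes 2k+2})$. In local terms, writing $\eta_i=f_i(z)\,dz$ in a local coordinate $z$: $Q\in\operatorname{Ker}(\mu_{2k-2})$ if and only if $\sum_{i,j}a_{ij}f_i^{(h)}f_j^{(n)}\equiv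 0$ for all $h,n\ge0$ with $h+n\le 2k-1$, and in that case $\mu_{2k}(Q)=(-1)^n\sum_{i,j}a_{ij}f_i^{(2k-n)}f_j^{(n)}\,(dz)^{2k+2}$ for any $n=0,\dots,2k$. *)

theory Defs
  imports "HOL-Complex_Analysis.Complex_Analysis" "HOL-Library.Function_Algebras"
begin

section \<open>Compact Riemann surfaces\<close>

text \<open>
  A chart is a pair of its domain and its coordinate function; the values of the coordinate
  function off the domain are irrelevant.
\<close>

type_synonym 'a chart = "'a set \<times> ('a \<Rightarrow> complex)"

definition chart_image :: "'a chart \<Rightarrow> complex set" where
  "chart_image c = snd c ` fst c"

definition chart_inv :: "'a chart \<Rightarrow> complex \<Rightarrow> 'a" where
  "chart_inv c = inv_into (fst c) (snd c)"

definition is_chart :: "'a topology \<Rightarrow> 'a chart \<Rightarrow> bool" where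
  "is_chart X c \<longleftrightarrow> openin X (fst c) \<and> open (chart_image c) \<and>
     homeomorphic_map (subtopology X (fst c)) (top_of_set (chart_image c)) (snd c)"

definition transition :: "'a chart \<Rightarrow> 'a chart \<Rightarrow> complex \<Rightarrow> complex" where
  "transition c d = snd d \<circ> chart_inv c"

definition holomorphic_atlas :: "'a topology \<Rightarrow> 'a chart set \<Rightarrow> bool" where
  "holomorphic_atlas X A \<longleftrightarrow> (\<forall>c\<in>A. is_chart X c) \<and> (\<Union>c\<in>A. fst c) = topspace X \<and>
     (\<forall>c\<in>A. \<forall>d\<in>A. transition c d holomorphic_on snd c ` (fst c \<inter> fst d))"

text \<open>
  A smooth complex projective (irreducible) curve is regarded as a compact connected Riemann
  surface, given by its topology and an atlas.  Second countability follows from compactness.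
\<close>

definition compact_riemann_surface :: "'a topology \<Rightarrow> 'a chart set \<Rightarrow> bool" where
  "compact_riemann_surface X A \<longleftrightarrow> topspace X \<noteq> {} \<and> Hausdorff_space X \<and> compact_space X \<and>
     connected_space X \<and> holomorphic_atlas X A"

section \<open>Holomorphic maps and their degree\<close>

definition holomorphic_map ::
  "'a topology \<Rightarrow> 'a chart set \<Rightarrow> 'b topology \<Rightarrow> 'b chart set \<Rightarrow> ('a \<Rightarrow> 'b) \<Rightarrow> bool" where
  "holomorphic_map X A Y B f \<longleftrightarrow> continuous_map X Y f \<and>
     (\<forall>c\<in>A. \<forall>d\<in>B. (snd d \<circ> f \<circ> chart_inv c) holomorphic_on snd c ` (fst c \<inter> f -` fst d))"

text \<open>
  The multiplicity of \<open>f\<close> at \<open>p\<close>: the order of vanishing at \<open>p\<close> of \<open>f - f p\<close>, read in charts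
  around \<open>p\<close> and \<open>f p\<close>.  It does not depend on the charts chosen.
\<close>

definition chart_at :: "'a chart set \<Rightarrow> 'a \<Rightarrow> 'a chart" where
  "chart_at A p = (SOME c. c \<in> A \<and> p \<in> fst c)"

definition map_mult :: "'a chart set \<Rightarrow> 'b chart set \<Rightarrow> ('a \<Rightarrow> 'b) \<Rightarrow> 'a \<Rightarrow> int" where
  "map_mult A B f p = (let c = chart_at A p; d = chart_at B (f p) in
     zorder (\<lambda>z. snd d (f (chart_inv c z)) - snd d (f p)) (snd c p))"

text \<open>
  \<open>f\<close> has degree \<open>m\<close> if every fibre consists of \<open>m\<close> points, counted with multiplicity.
\<close>

definition has_degree ::
  "'a topology \<Rightarrow> 'a chart set \<Rightarrow> 'b topology \<Rightarrow> 'b chart set \<Rightarrow> ('a \<Rightarrow> 'b) \<Rightarrow> nat \<Rightarrow> bool" where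
  "has_degree X A Y B f m \<longleftrightarrow> (\<forall>q\<in>topspace Y. finite {p \<in> topspace X. f p = q} \<and>
     (\<Sum>p | p \<in> topspace X \<and> f p = q. map_mult A B f p) = int m)"

text \<open>
  The projective line as the one-point compactification of the complex plane, with the point
  \<open>None\<close> at infinity and the two standard charts \<open>z\<close> and \<open>1/z\<close>.
\<close>

definition proj_line :: "complex option topology" where
  "proj_line = Alexandroff_compactification euclidean"

definition proj_line_atlas :: "complex option chart set" where
  "proj_line_atlas =
     {(range Some, the), (- {Some 0}, \<lambda>q. case q of None \<Rightarrow> 0 | Some z \<Rightarrow> 1 / z)}"

section \<open>Holomorphic one-forms, genus, hyperelliptic curves\<close>

text \<open>
  Spaces of sections are realised as spaces of complex-valued functions with the pointwise
  operations.
\<close>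

definition cscale :: "complex \<Rightarrow> ('i \<Rightarrow> complex) \<Rightarrow> 'i \<Rightarrow> complex" where
  "cscale a f = (\<lambda>i. a * f i)"

interpretation cfun: vector_space "cscale :: complex \<Rightarrow> ('i \<Rightarrow> complex) \<Rightarrow> 'i \<Rightarrow> complex"
  by unfold_locales (auto simp: cscale_def fun_eq_iff algebra_simps)

text \<open>
  The space \<open>H\<^sup>0(C,K\<^sub>C)\<close>.  A one-form \<open>\<eta>\<close> is the function whose value at \<open>(c, z)\<close> is \<open>f(z)\<close>, where
  \<open>f(z) dz\<close> is the expression of the form in the chart \<open>c\<close>.  To make the representing function
  unique, it is \<open>0\<close> at pairs \<open>(c, z)\<close> that do not describe a point of the surface.
\<close>

definition canonical_forms :: "'a chart set \<Rightarrow> ('a chart \<times> complex \<Rightarrow> complex) set" where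
  "canonical_forms A = {\<eta>.
     (\<forall>c\<in>A. (\<lambda>z. \<eta> (c, z)) holomorphic_on chart_image c) \<and>
     (\<forall>c\<in>A. \<forall>d\<in>A. \<forall>p\<in>fst c \<inter> fst d.
        \<eta> (c, snd c p) = \<eta> (d, snd d p) * deriv (transition c d) (snd c p)) \<and>
     (\<forall>c z. c \<notin> A \<or> z \<notin> chart_image c \<longrightarrow> \<eta> (c, z) = 0)}"

definition genus :: "'a chart set \<Rightarrow> nat" where
  "genus A = cfun.dim (canonical_forms A)"

definition hyperelliptic :: "'a topology \<Rightarrow> 'a chart set \<Rightarrow> bool" where
  "hyperelliptic X A \<longleftrightarrow> genus A \<ge> 2 \<and>
     (\<exists>f. holomorphic_map X A proj_line proj_line_atlas f \<and>
          has_degree X A proj_line proj_line_atlas f 2)"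

section \<open>Even Gaussian maps of the canonical bundle\<close>

text \<open>
  \<open>\<eta> \<otimes> \<theta>\<close> is realised as the function \<open>(u, v) \<mapsto> \<eta> u * \<theta> v\<close>, that is, as a section of
  the external product of \<open>K\<^sub>C\<close> with itself on \<open>C \<times> C\<close>; this identification is injective on
  the algebraic tensor product.
\<close>

definition sym_square :: "('i \<Rightarrow> complex) set \<Rightarrow> ('i \<times> 'i \<Rightarrow> complex) set" where
  "sym_square V = {Q. \<exists>(N::nat) a \<eta>.
     (\<forall>i<N. \<eta> i \<in> V) \<and> (\<forall>i<N. \<forall>j<N. a i j = a j i) \<and>
     Q = (\<lambda>(u, v). \<Sum>i<N. \<Sum>j<N. a i j * \<eta> i u * \<eta> j v)}"

text \<open>
  The value of \<open>\<mu>\<close> of index \<open>2k\<close> at \<open>Q\<close>, as a coefficient of \<open>(dz)\<close> to the power \<open>2k + 2\<close>: the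
  derivative of order \<open>2k\<close> of \<open>Q\<close> in the first variable, restricted to the diagonal.  This is the
  case \<open>n = 0\<close> of the local formula, see \<open>gauss_map_tensor\<close> below.  (Dividing \<open>Q\<close> by the power
  \<open>2k\<close> of the equation \<open>z - w\<close> of the diagonal and restricting gives the same up to the
  nonzero constant factor \<open>(2k)!\<close>.)
\<close>

definition gauss_map ::
  "nat \<Rightarrow> (('a chart \<times> complex) \<times> ('a chart \<times> complex) \<Rightarrow> complex) \<Rightarrow> 'a chart \<times> complex \<Rightarrow> complex"
  where "gauss_map k Q = (\<lambda>(c, z). (deriv ^^ (2 * k)) (\<lambda>t. Q ((c, t), (c, z))) z)"

primrec gauss_dom ::
  "'a chart set \<Rightarrow> nat \<Rightarrow> (('a chart \<times> complex) \<times> ('a chart \<times> complex) \<Rightarrow> complex) set" where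
  "gauss_dom A 0 = sym_square (canonical_forms A)"
| "gauss_dom A (Suc k) = {Q \<in> gauss_dom A k. gauss_map k Q = 0}"

definition gauss_ker ::
  "'a chart set \<Rightarrow> nat \<Rightarrow> (('a chart \<times> complex) \<times> ('a chart \<times> complex) \<Rightarrow> complex) set" where
  "gauss_ker A k = {Q \<in> gauss_dom A k. gauss_map k Q = 0}"

definition gauss_rank :: "'a chart set \<Rightarrow> nat \<Rightarrow> nat" where
  "gauss_rank A k = cfun.dim (gauss_map k ` gauss_dom A k)"

lemma higher_deriv_sum_cmult:
  assumes "finite I" "\<And>i. i \<in> I \<Longrightarrow> f i holomorphic_on S" "open S" "z \<in> S"
  shows "(deriv ^^ n) (\<lambda>t. \<Sum>i\<in>I. b i * f i t) z = (\<Sum>i\<in>I. b i * (deriv ^^ n) (f i) z)"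
  using assms(1,2)
proof (induction I rule: finite_induct)
  case empty
  show ?case by (simp add: higher_deriv_const)
next
  case (insert j I)
  have hol: "(\<lambda>t. b i * f i t) holomorphic_on S" if "i \<in> insert j I" for i
    by (intro holomorphic_on_mult holomorphic_on_const insert.prems that)
  have "(deriv ^^ n) (\<lambda>t. b j * f j t + (\<Sum>i\<in>I. b i * f i t)) z =
        (deriv ^^ n) (\<lambda>t. b j * f j t) z + (deriv ^^ n) (\<lambda>t. \<Sum>i\<in>I. b i * f i t) z"
    by (rule higher_deriv_add[where S = S])
       (auto intro!: hol holomorphic_on_sum assms(3,4))
  also have "(deriv ^^ n) (\<lambda>t. b j * f j t) z = b j * (deriv ^^ n) (f j) z"
    by (rule higher_deriv_cmult[where A = S]) (auto intro!: insert.prems assms(3,4))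
  finally show ?case
    using insert by simp
qed

lemma gauss_map_tensor:
  fixes N :: nat
  assumes "\<And>i. i < N \<Longrightarrow> \<eta> i \<in> canonical_forms A"
    and "c \<in> A" "is_chart X c" "z \<in> chart_image c"
  shows "gauss_map k (\<lambda>(u, v). \<Sum>i<N. \<Sum>j<N. a i j * \<eta> i u * \<eta> j v) (c, z) =
    (\<Sum>i<N. \<Sum>j<N. a i j * (deriv ^^ (2 * k)) (\<lambda>t. \<eta> i (c, t)) z * \<eta> j (c, z))"
proof -
  have "(deriv ^^ (2*k)) (\<lambda>t. \<Sum>i<N. (\<Sum>j<N. a i j * \<eta> j (c, z)) * \<eta> i (c, t)) z =
    (\<Sum>i<N. (\<Sum>j<N. a i j * \<eta> j (c, z)) * (deriv ^^ (2*k)) (\<lambda>t. \<eta> i (c, t)) z)"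
  proof (rule higher_deriv_sum_cmult)
    show "(\<lambda>t. \<eta> i (c, t)) holomorphic_on chart_image c" if "i \<in> {..<N}" for i
      using assms(1)[of i] assms(2) that by (simp add: canonical_forms_def)
  qed (use assms(3,4) in \<open>auto simp: is_chart_def\<close>)
  then show ?thesis
    by (simp add: gauss_map_def sum_distrib_left sum_distrib_right mult_ac)
qed

end

theory Submission
  imports Defs
begin

text \<open>
  Let \<open>h : C \<rightarrow> P\<^sup>1\<close> be the double cover.  A one-form \<open>\<eta>\<close> on \<open>C\<close> has a trace on \<open>P\<^sup>1\<close>, whose
  coefficient with respect to \<open>dz\<close> is the sum of \<open>\<eta>/dh\<close> over the fibre; it extends to a holomorphic
  one-form on \<open>P\<^sup>1\<close> and hence vanishes (\<open>trace_eq_0\<close>).  Choose a value \<open>a\<close> that is not a branch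
  value, let \<open>p1\<close>, \<open>p2\<close> be the two points above it and put \<open>u = 1/(h - a)\<close>, a function with simple
  poles at \<open>p1\<close> and \<open>p2\<close> only.  Vanishing of the trace at \<open>a\<close> says that a form vanishing at \<open>p1\<close>
  also vanishes at \<open>p2\<close>, so that its product with \<open>u\<close> is again a holomorphic form.

  Take \<open>\<omega> \<noteq> 0\<close> such that \<open>\<omega>, u \<omega>, \<dots>, u\<^sup>n \<omega>\<close> are all holomorphic with \<open>n\<close> maximal.  By maximality
  \<open>u\<^sup>n \<omega>\<close> does not vanish at \<open>p1\<close>.  Given any form \<open>\<eta>\<close>, one can therefore subtract a combination of
  the \<open>u\<^sup>i \<omega>\<close> and obtain a form that stays holomorphic after multiplication with every power of \<open>u\<close>
  up to \<open>u\<^sup>n\<^sup>+\<^sup>1\<close>; by maximality that form is \<open>0\<close>.  So the forms \<open>u\<^sup>i \<omega>\<close> are a basis of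
  \<open>H\<^sup>0(C,K\<^sub>C)\<close>, and \<open>n = g - 1\<close> (\<open>canonical_forms_basis\<close>).

  Consequently \<open>S\<^sup>2H\<^sup>0(C,K\<^sub>C)\<close> is the space of tensors \<open>P(u p, u q) \<omega>(p) \<omega>(q)\<close> with \<open>P\<close> a symmetric polynomial
  of degree at most \<open>g - 1\<close> in each variable.  If \<open>P = (x - y)\<^sup>2\<^sup>l R\<close>, then \<open>\<mu>\<close> of index \<open>2k\<close> kills the
  tensor for \<open>k < l\<close>, and for \<open>k = l\<close> it yields \<open>(2l)! R(u,u) (du)\<^sup>2\<^sup>l \<omega>\<^sup>2\<close> (\<open>gauss_map_stratum\<close>).
  For every \<open>l\<close> with \<open>2l \<le> g - 1\<close> the diagonal values \<open>R(x,x)\<close> can be any power \<open>x\<^sup>s\<close> with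
  \<open>s \<le> 2(g - 1 - 2l)\<close>.  The resulting family indexed by \<open>(l,s)\<close> is linearly independent and has
  \<open>g(g+1)/2\<close> members, so it is a basis of \<open>S\<^sup>2H\<^sup>0(C,K\<^sub>C)\<close>, adapted to the filtration by the kernels
  (\<open>kernel_filtration\<close>, \<open>gauss_filtration\<close>).  Counting the pairs with \<open>l = k\<close> gives the rank of \<open>\<mu>\<close>
  of index \<open>2k\<close>, and counting those with \<open>l > k\<close> gives the dimension of its kernel.
\<close>

section \<open>Complex analysis in one variable\<close>

lemma open_infinite_complex: "open (S :: complex set) \<Longrightarrow> S \<noteq> {} \<Longrightarrow> infinite S"
  using finite_imp_not_open by blast

lemma continuous_eq_off_finite:
  fixes f g :: "complex \<Rightarrow> complex"
  assumes "open S" "finite K" "continuous_on S f" "continuous_on S g"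
    and eq: "\<And>t. t \<in> S - K \<Longrightarrow> f t = g t" and t: "t \<in> S"
  shows "f t = g t"
proof -
  have f: "(f \<longlongrightarrow> f t) (at t)" and g: "(g \<longlongrightarrow> g t) (at t)"
    using assms by (auto simp: continuous_on_eq_continuous_at isCont_def)
  have "open (S - (K - {t}))"
    using assms by (intro open_Diff finite_imp_closed) auto
  then have "\<forall>\<^sub>F x in at t. x \<in> S - (K - {t}) - {t}"
    by (rule eventually_at_in_open) (use t in auto)
  then have "\<forall>\<^sub>F x in at t. f x = g x"
    by eventually_elim (use eq in auto)
  with f have "(g \<longlongrightarrow> f t) (at t)"
    by (rule Lim_transform_eventually)
  with g show ?thesis
    by (metis tendsto_unique trivial_limit_at)
qed

text \<open>
  Write \<open>F = (t - \<zeta>)\<^sup>n G\<close> with \<open>G(\<zeta>) \<noteq> 0\<close>; then \<open>F/F'\<close> behaves like \<open>(t - \<zeta>)/n\<close>.  This controls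
  \<open>\<eta>/dF\<close> at points where \<open>dF\<close> vanishes, whatever the ramification order.
\<close>

lemma zero_over_deriv:
  fixes F :: "complex \<Rightarrow> complex"
  assumes S: "open S" "F holomorphic_on S" "\<zeta> \<in> S" and zero: "F \<zeta> = 0"
    and fin: "finite {t \<in> S. F t = 0}"
  shows "\<forall>\<^sub>F t in at \<zeta>. F t \<noteq> 0 \<and> deriv F t \<noteq> 0"
    and "((\<lambda>t. F t / deriv F t) \<longlongrightarrow> 0) (at \<zeta>)"
proof -
  obtain \<rho> where \<rho>: "\<rho> > 0" "ball \<zeta> \<rho> \<subseteq> S"
    using S open_contains_ball by blast
  have nc: "\<not> F constant_on ball \<zeta> \<rho>"
  proof
    assume "F constant_on ball \<zeta> \<rho>"
    then have "ball \<zeta> \<rho> \<subseteq> {t \<in> S. F t = 0}"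
      using \<rho> zero unfolding constant_on_def by force
    then show False
      using fin open_infinite_complex[of "ball \<zeta> \<rho>"] \<rho> finite_subset by fastforce
  qed
  obtain G r n where G: "0 < n" "0 < r" "ball \<zeta> r \<subseteq> ball \<zeta> \<rho>" "G holomorphic_on ball \<zeta> r"
      "\<And>w. w \<in> ball \<zeta> r \<Longrightarrow> F w = (w - \<zeta>) ^ n * G w"
      "\<And>w. w \<in> ball \<zeta> r \<Longrightarrow> G w \<noteq> 0"
    by (rule holomorphic_factor_zero_nonconstant[of F "ball \<zeta> \<rho>" \<zeta>])
       (use S \<rho> zero nc in \<open>auto intro: holomorphic_on_subset\<close>)
  define H where "H = (\<lambda>w. of_nat n * G w + (w - \<zeta>) * deriv G w)"
  have dF: "deriv F w = (w - \<zeta>) ^ (n - 1) * H w" if w: "w \<in> ball \<zeta> r" for w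
  proof -
    have "(G has_field_derivative deriv G w) (at w)"
      using G(4) w by (auto intro: holomorphic_derivI)
    then have "((\<lambda>w. (w - \<zeta>) ^ n * G w) has_field_derivative
        (w - \<zeta>) ^ n * deriv G w + of_nat n * (w - \<zeta>) ^ (n - 1) * G w) (at w)"
      by (auto intro!: derivative_eq_intros)
    also have "(w - \<zeta>) ^ n * deriv G w + of_nat n * (w - \<zeta>) ^ (n - 1) * G w = (w - \<zeta>) ^ (n - 1) * H w"
      using G(1) by (cases n) (auto simp: H_def algebra_simps)
    finally have "(F has_field_derivative (w - \<zeta>) ^ (n - 1) * H w) (at w)"
      by (rule has_field_derivative_transform_within_open[of _ _ _ "ball \<zeta> r"]) (use w G(5) in auto)
    then show ?thesis by (rule DERIV_imp_deriv)
  qed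
  have contH: "isCont H \<zeta>"
  proof -
    have "H holomorphic_on ball \<zeta> r"
      unfolding H_def by (intro holomorphic_intros G) auto
    then show ?thesis
      using G(2) by (intro continuous_on_interior[of "ball \<zeta> r"] holomorphic_on_imp_continuous_on) auto
  qed
  have contG: "isCont G \<zeta>"
    using G(2,4) by (intro continuous_on_interior[of "ball \<zeta> r"] holomorphic_on_imp_continuous_on) auto
  have H0: "H \<zeta> \<noteq> 0" using G(1,2,6) by (auto simp: H_def)
  have evH: "\<forall>\<^sub>F w in at \<zeta>. H w \<noteq> 0"
    using contH H0 unfolding isCont_def by (rule tendsto_imp_eventually_ne)
  have evb: "\<forall>\<^sub>F w in at \<zeta>. w \<in> ball \<zeta> r - {\<zeta>}"
    using G(2) by (intro eventually_at_in_open) auto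
  show "\<forall>\<^sub>F t in at \<zeta>. F t \<noteq> 0 \<and> deriv F t \<noteq> 0"
    using evH evb by eventually_elim (use dF G in auto)
  have "((\<lambda>w. (w - \<zeta>) * G w / H w) \<longlongrightarrow> (\<zeta> - \<zeta>) * G \<zeta> / H \<zeta>) (at \<zeta>)"
    using contG contH H0 unfolding isCont_def by (intro tendsto_intros) auto
  moreover have "\<forall>\<^sub>F w in at \<zeta>. (w - \<zeta>) * G w / H w = F w / deriv F w"
    using evb
  proof eventually_elim
    case (elim w)
    then have "(w - \<zeta>) ^ n = (w - \<zeta>) ^ (n - 1) * (w - \<zeta>)" "(w - \<zeta>) ^ (n - 1) \<noteq> 0"
      using G(1) by (auto simp flip: power_Suc2)
    then show ?case using dF[of w] G(5)[of w] elim by simp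
  qed
  ultimately show "((\<lambda>t. F t / deriv F t) \<longlongrightarrow> 0) (at \<zeta>)"
    by (auto intro: Lim_transform_eventually)
qed

lemma quotient_at_simple_zero:
  fixes f v :: "complex \<Rightarrow> complex"
  assumes "(f has_field_derivative f') (at \<zeta>)" "(v has_field_derivative v') (at \<zeta>)"
    and "f \<zeta> = 0" "v \<zeta> = 0" "v' \<noteq> 0"
  shows "((\<lambda>t. f t / v t) \<longlongrightarrow> f' / v') (at \<zeta>)"
proof -
  have "((\<lambda>t. (f t / (t - \<zeta>)) / (v t / (t - \<zeta>))) \<longlongrightarrow> f' / v') (at \<zeta>)"
    using assms unfolding has_field_derivative_iff by (intro tendsto_divide) auto
  moreover have "\<forall>\<^sub>F t in at \<zeta>. (f t / (t - \<zeta>)) / (v t / (t - \<zeta>)) = f t / v t"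
    using eventually_neq_at_within[of \<zeta>] by eventually_elim auto
  ultimately show ?thesis by (rule Lim_transform_eventually)
qed

text \<open>
  The condition at \<open>b \<in> B\<close> excludes even a simple pole, so all points of \<open>B\<close> are removable and
  Liouville's theorem applies.  In terms of the one-form \<open>f(z) dz\<close>: there is no nonzero holomorphic
  one-form on the projective line.
\<close>

lemma holomorphic_vanishing_at_infinity:
  fixes f :: "complex \<Rightarrow> complex"
  assumes "finite B" "f holomorphic_on - B"
    and "\<And>b. b \<in> B \<Longrightarrow> ((\<lambda>z. (z - b) * f z) \<longlongrightarrow> 0) (at b)"
    and "(f \<longlongrightarrow> 0) at_infinity"
    and "z \<notin> B"
  shows "f z = 0"
  using assms
proof (induction B arbitrary: f rule: finite_induct)
  case empty
  then show ?case using Liouville_weak_0[of f z] by simp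
next
  case (insert b B)
  have op: "open (- B)"
    using insert.hyps(1) by (simp add: open_Compl finite_imp_closed)
  have "- insert b B = - B - {b}" by auto
  then have "f holomorphic_on - B - {b}" using insert.prems by simp
  moreover have "b \<in> interior (- B)" using op insert.hyps by (simp add: interior_open)
  ultimately obtain g where g: "g holomorphic_on - B" "\<And>w. w \<in> - B - {b} \<Longrightarrow> g w = f w"
    using holomorphic_on_extend_lim[of f "- B" b] insert.prems(2)[of b] by auto
  have "g z = 0"
  proof (rule insert.IH)
    show "((\<lambda>z. (z - b') * g z) \<longlongrightarrow> 0) (at b')" if b': "b' \<in> B" for b'
    proof -
      have "open (- (insert b B - {b'}))"
        using insert.hyps(1) by (intro open_Compl finite_imp_closed) auto
      then have "\<forall>\<^sub>F w in at b'. w \<in> - (insert b B - {b'}) - {b'}"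
        by (rule eventually_at_in_open) auto
      then have "\<forall>\<^sub>F w in at b'. (w - b') * f w = (w - b') * g w"
        by eventually_elim (use g in auto)
      with insert.prems(2)[of b'] b' show ?thesis
        by (auto intro: Lim_transform_eventually)
    qed
    have "bounded (insert b B)" using insert.hyps by auto
    then obtain R where R: "\<And>w. w \<in> insert b B \<Longrightarrow> norm w \<le> R" unfolding bounded_iff by auto
    have "\<forall>\<^sub>F w in at_infinity. f w = g w"
      unfolding eventually_at_infinity
    proof (intro exI allI impI)
      fix w :: complex assume "R + 1 \<le> norm w"
      then have "w \<notin> insert b B" using R[of w] by auto
      then show "f w = g w" using g(2)[of w] by auto
    qed
    with insert.prems(3) show "(g \<longlongrightarrow> 0) at_infinity"
      by (rule Lim_transform_eventually)
  qed (use g insert.prems in auto)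
  then show ?case using g insert.prems by auto
qed

text \<open>
  In the Leibniz expansion at \<open>z\<close> only the terms survive in which each of the \<open>m\<close> factors
  \<open>x t - x z\<close> has been differentiated once.
\<close>

lemma higher_deriv_power_mult:
  fixes x H :: "complex \<Rightarrow> complex"
  assumes "open S" "z \<in> S" "x holomorphic_on S" "H holomorphic_on S"
  shows "(deriv ^^ m) (\<lambda>t. (x t - x z) ^ m * H t) z = fact m * deriv x z ^ m * H z"
  using assms(4)
proof (induction m arbitrary: H)
  case (Suc m)
  define H' where "H' = (\<lambda>t. of_nat (Suc m) * deriv x t * H t + (x t - x z) * deriv H t)"
  have hol: "H' holomorphic_on S"
    unfolding H'_def using assms Suc.prems by (intro holomorphic_intros)
  have D: "deriv (\<lambda>t. (x t - x z) ^ Suc m * H t) t = (x t - x z) ^ m * H' t" if t: "t \<in> S" for t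
  proof -
    have "(x has_field_derivative deriv x t) (at t)" "(H has_field_derivative deriv H t) (at t)"
      using assms Suc.prems t by (auto intro: holomorphic_derivI)
    then have "((\<lambda>t. (x t - x z) ^ Suc m * H t) has_field_derivative
        (x t - x z) ^ Suc m * deriv H t + of_nat (Suc m) * (x t - x z) ^ m * deriv x t * H t) (at t)"
      by (auto intro!: derivative_eq_intros simp del: power_Suc)
    then have "deriv (\<lambda>t. (x t - x z) ^ Suc m * H t) t =
        (x t - x z) ^ Suc m * deriv H t + of_nat (Suc m) * (x t - x z) ^ m * deriv x t * H t"
      by (rule DERIV_imp_deriv)
    then show ?thesis by (simp add: H'_def algebra_simps)
  qed
  have "(deriv ^^ Suc m) (\<lambda>t. (x t - x z) ^ Suc m * H t) z =
        (deriv ^^ m) (deriv (\<lambda>t. (x t - x z) ^ Suc m * H t)) z"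
    by (simp only: funpow_Suc_right o_apply)
  also have "\<dots> = (deriv ^^ m) (\<lambda>t. (x t - x z) ^ m * H' t) z"
    by (rule higher_deriv_transform_within_open[of _ S])
       (use assms hol D Suc.prems in \<open>auto intro!: holomorphic_intros holomorphic_deriv\<close>)
  also have "\<dots> = fact (Suc m) * deriv x z ^ Suc m * H z"
    using Suc.IH[OF hol] by (simp add: H'_def algebra_simps)
  finally show ?case .
qed simp

lemma higher_deriv_power_mult_less:
  fixes x H :: "complex \<Rightarrow> complex"
  assumes "open S" "z \<in> S" "x holomorphic_on S" "H holomorphic_on S" "m < l"
  shows "(deriv ^^ m) (\<lambda>t. (x t - x z) ^ l * H t) z = 0"
proof -
  have "(\<lambda>t. (x t - x z) ^ l * H t) = (\<lambda>t. (x t - x z) ^ m * ((x t - x z) ^ (l - m) * H t))"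
    using assms(5) by (simp add: fun_eq_iff flip: power_add mult.assoc)
  moreover have "(\<lambda>t. (x t - x z) ^ (l - m) * H t) holomorphic_on S"
    using assms by (intro holomorphic_intros)
  ultimately have "(deriv ^^ m) (\<lambda>t. (x t - x z) ^ l * H t) z =
      fact m * deriv x z ^ m * ((x z - x z) ^ (l - m) * H z)"
    using higher_deriv_power_mult[OF assms(1-3), of "\<lambda>t. (x t - x z) ^ (l - m) * H t" m]
    by simp
  then show ?thesis using assms(5) by simp
qed

section \<open>Linear algebra in spaces of functions\<close>

lemma sum_fun_apply: "(\<Sum>i\<in>I. f i) x = (\<Sum>i\<in>I. f i x)"
  for f :: "'b \<Rightarrow> 'c \<Rightarrow> complex"
  by (induction I rule: infinite_finite_induct) auto

lemma cscale_apply: "cscale a f x = a * f x"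
  by (simp add: cscale_def)

lemma cfun_span_family:
  assumes "finite I"
  shows "cfun.span (b ` I) = range (\<lambda>a. \<Sum>i\<in>I. cscale (a i) (b i))" (is "_ = ?R")
proof
  have "cfun.subspace ?R"
  proof (rule cfun.subspaceI)
    have "0 = (\<Sum>i\<in>I. cscale 0 (b i))" by simp
    then show "0 \<in> ?R" by (rule range_eqI[of _ _ "\<lambda>_. 0"])
  next
    fix x y assume "x \<in> ?R" "y \<in> ?R"
    then obtain a a' where "x = (\<Sum>i\<in>I. cscale (a i) (b i))" "y = (\<Sum>i\<in>I. cscale (a' i) (b i))"
      by blast
    then have "x + y = (\<Sum>i\<in>I. cscale (a i + a' i) (b i))"
      by (simp add: sum.distrib cfun.scale_left_distrib)
    then show "x + y \<in> ?R" by (rule range_eqI[of _ _ "\<lambda>i. a i + a' i"])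
  next
    fix c x assume "x \<in> ?R"
    then obtain a where "x = (\<Sum>i\<in>I. cscale (a i) (b i))" by blast
    then have "cscale c x = (\<Sum>i\<in>I. cscale (c * a i) (b i))"
      by (simp add: cfun.scale_sum_right)
    then show "cscale c x \<in> ?R" by (rule range_eqI[of _ _ "\<lambda>i. c * a i"])
  qed
  moreover have "b ` I \<subseteq> ?R"
  proof
    fix x assume "x \<in> b ` I"
    then obtain j where j: "j \<in> I" "x = b j" by blast
    have "(\<Sum>i\<in>I. cscale (if i = j then 1 else 0) (b i)) = (\<Sum>i\<in>I. if i = j then b i else 0)"
      by (rule sum.cong) auto
    also have "\<dots> = x" using j assms by simp
    finally show "x \<in> ?R" by (intro range_eqI[of _ _ "\<lambda>i. if i = j then 1 else 0"]) simp
  qed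
  ultimately show "cfun.span (b ` I) \<subseteq> ?R" by (intro cfun.span_minimal)
  show "?R \<subseteq> cfun.span (b ` I)"
    by (blast intro: cfun.span_sum cfun.span_scale cfun.span_base imageI)
qed

lemma cfun_independent_family:
  assumes "finite I"
    and ind: "\<And>a i. (\<Sum>i\<in>I. cscale (a i) (b i)) = 0 \<Longrightarrow> i \<in> I \<Longrightarrow> a i = 0"
  shows "inj_on b I" and "cfun.independent (b ` I)"
proof -
  show inj: "inj_on b I"
  proof (rule inj_onI, rule ccontr)
    fix i j assume ij: "i \<in> I" "j \<in> I" "b i = b j" "i \<noteq> j"
    define a :: "'a \<Rightarrow> complex" where "a = (\<lambda>k. if k = i then 1 else if k = j then -1 else 0)"
    have "(\<Sum>k\<in>I. cscale (a k) (b k)) = (\<Sum>k\<in>{i, j}. cscale (a k) (b k))"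
      using ij assms(1) by (intro sum.mono_neutral_right) (auto simp: a_def)
    also have "\<dots> = 0" using ij by (auto simp: a_def)
    finally show False using ind[of a i] ij by (simp add: a_def)
  qed
  show "cfun.independent (b ` I)"
  proof (rule cfun.independent_if_scalars_zero)
    show "finite (b ` I)" using assms(1) by simp
    fix f x assume f: "(\<Sum>x\<in>b ` I. cscale (f x) x) = 0" and x: "x \<in> b ` I"
    have "(\<Sum>i\<in>I. cscale (f (b i)) (b i)) = 0"
      using f by (simp add: sum.reindex[OF inj])
    then show "f x = 0" using ind[of "\<lambda>i. f (b i)"] x by blast
  qed
qed

lemma cfun_dim_span_family:
  assumes "finite I"
    and "\<And>a i. (\<Sum>i\<in>I. cscale (a i) (b i)) = 0 \<Longrightarrow> i \<in> I \<Longrightarrow> a i = 0"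
  shows "cfun.dim (cfun.span (b ` I)) = card I"
proof -
  have "inj_on b I" "cfun.independent (b ` I)"
    by (rule cfun_independent_family; use assms in blast)+
  then show ?thesis using cfun.dim_span_eq_card_independent[of "b ` I"] card_image[of b I] by metis
qed

definition tensor_square :: "('i \<Rightarrow> complex) \<Rightarrow> 'i \<times> 'i \<Rightarrow> complex" where
  "tensor_square \<eta> = (\<lambda>(u, v). \<eta> u * \<eta> v)"

lemma tensor_square_apply [simp]: "tensor_square \<eta> (u, v) = \<eta> u * \<eta> v"
  by (simp add: tensor_square_def)

text \<open>
  Polarisation: \<open>\<eta> \<otimes> \<theta> + \<theta> \<otimes> \<eta>\<close> is a combination of the squares of \<open>\<eta> + \<theta>\<close>, \<open>\<eta>\<close> and \<open>\<theta>\<close>.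
\<close>

lemma sym_square_eq_span:
  assumes V: "cfun.subspace V"
  shows "sym_square V = cfun.span (tensor_square ` V)"
proof
  show "sym_square V \<subseteq> cfun.span (tensor_square ` V)"
  proof
    fix Q assume "Q \<in> sym_square V"
    then obtain N :: nat and a \<eta> where \<eta>: "\<And>i. i < N \<Longrightarrow> \<eta> i \<in> V"
      and a: "\<And>i j. i < N \<Longrightarrow> j < N \<Longrightarrow> a i j = a j i"
      and Q: "Q = (\<lambda>(u, v). \<Sum>i<N. \<Sum>j<N. a i j * \<eta> i u * \<eta> j v)"
      unfolding sym_square_def by blast
    have "Q = (\<Sum>i<N. \<Sum>j<N. cscale (a i j / 2)
        (tensor_square (\<eta> i + \<eta> j) - tensor_square (\<eta> i) - tensor_square (\<eta> j)))" (is "_ = ?R")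
    proof
      fix w :: "'a \<times> 'a"
      obtain u v where w: "w = (u, v)" by force
      have swap: "(\<Sum>i<N. \<Sum>j<N. a i j * \<eta> j u * \<eta> i v) = (\<Sum>i<N. \<Sum>j<N. a i j * \<eta> i u * \<eta> j v)"
        by (subst sum.swap) (intro sum.cong refl, use a in auto)
      have "?R w = (\<Sum>i<N. \<Sum>j<N. (a i j * \<eta> i u * \<eta> j v + a i j * \<eta> j u * \<eta> i v) / 2)"
        unfolding w by (auto simp: sum_fun_apply cscale_apply algebra_simps intro!: sum.cong)
      also have "\<dots> = Q w"
        unfolding w Q by (simp add: add_divide_distrib sum.distrib swap flip: sum_divide_distrib)
      finally show "Q w = ?R w" ..
    qed
    also have "\<dots> \<in> cfun.span (tensor_square ` V)"
      using \<eta> V by (intro cfun.span_sum cfun.span_scale cfun.span_diff cfun.span_base imageI cfun.subspace_add) auto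
    finally show "Q \<in> cfun.span (tensor_square ` V)" .
  qed
  show "cfun.span (tensor_square ` V) \<subseteq> sym_square V"
  proof
    fix Q assume "Q \<in> cfun.span (tensor_square ` V)"
    then obtain t r where t: "finite t" "t \<subseteq> tensor_square ` V" "Q = (\<Sum>q\<in>t. cscale (r q) q)"
      unfolding cfun.span_explicit by blast
    obtain h :: "nat \<Rightarrow> _" where h: "bij_betw h {..<card t} t"
      using ex_bij_betw_nat_finite[OF t(1)] atLeast0LessThan by metis
    have "\<forall>q\<in>t. \<exists>\<eta>\<in>V. q = tensor_square \<eta>" using t(2) by blast
    then obtain s where s: "\<And>q. q \<in> t \<Longrightarrow> s q \<in> V \<and> q = tensor_square (s q)" by metis
    define a where "a = (\<lambda>i j. if i = j then r (h i) else 0)"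
    have ht: "h i \<in> t" if "i < card t" for i using h that by (auto simp: bij_betw_def)
    have "Q = (\<lambda>(u, v). \<Sum>i<card t. \<Sum>j<card t. a i j * s (h i) u * s (h j) v)"
    proof
      fix w :: "'a \<times> 'a"
      obtain u v where w: "w = (u, v)" by force
      have "Q w = (\<Sum>q\<in>t. r q * q w)" by (simp add: t(3) sum_fun_apply cscale_apply)
      also have "\<dots> = (\<Sum>i<card t. r (h i) * h i w)"
        by (rule sum.reindex_bij_betw[OF h, symmetric])
      also have "\<dots> = (\<Sum>i<card t. r (h i) * (s (h i) u * s (h i) v))"
      proof (rule sum.cong[OF refl])
        fix i assume "i \<in> {..<card t}"
        then have "h i = tensor_square (s (h i))" using s ht by blast
        then have "h i w = s (h i) u * s (h i) v" by (metis tensor_square_apply w)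
        then show "r (h i) * h i w = r (h i) * (s (h i) u * s (h i) v)" by simp
      qed
      also have "\<dots> = (\<Sum>i<card t. \<Sum>j<card t. if j = i then r (h i) * s (h i) u * s (h j) v else 0)"
        by (simp add: mult_ac)
      also have "\<dots> = (\<Sum>i<card t. \<Sum>j<card t. a i j * s (h i) u * s (h j) v)"
        by (intro sum.cong) (auto simp: a_def)
      finally show "Q w = (case w of (u, v) \<Rightarrow> \<Sum>i<card t. \<Sum>j<card t. a i j * s (h i) u * s (h j) v)"
        by (simp add: w)
    qed
    moreover have "\<forall>i<card t. s (h i) \<in> V" "\<forall>i<card t. \<forall>j<card t. a i j = a j i"
      using s ht by (auto simp: a_def)
    ultimately show "Q \<in> sym_square V"
      unfolding sym_square_def
      by (intro CollectI exI[of _ "card t"] exI[of _ a] exI[of _ "\<lambda>i. s (h i)"] conjI)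
  qed
qed

text \<open>
  An upper bound for the dimension of the symmetric square; the independent family that attains it
  is found in \<open>gauss_filtration\<close>.
\<close>

lemma sym_square_spanning_set:
  fixes e :: "nat \<Rightarrow> 'i \<Rightarrow> complex"
  assumes V: "V = cfun.span (e ` {..<g})"
  obtains T where "finite T" "card T \<le> g * (g + 1) div 2" "sym_square V \<subseteq> cfun.span T"
proof -
  define s where "s = (\<lambda>(i, j). \<lambda>(u, v). e i u * e j v + e j u * e i v)"
  define J where "J = (SIGMA j:{..<g}. {..j})"
  have finJ: "finite J" by (simp add: J_def)
  have "card J = (\<Sum>j<g. Suc j)" by (simp add: J_def)
  also have "\<dots> = g * (g + 1) div 2"
    by (induction g) auto
  finally have cardJ: "card J = g * (g + 1) div 2" .
  have sJ: "s (i, j) \<in> cfun.span (s ` J)" if "i < g" "j < g" for i j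
  proof (cases "j \<le> i")
    case True
    then show ?thesis using that by (intro cfun.span_base imageI) (auto simp: J_def)
  next
    case False
    have "s (i, j) = s (j, i)" by (auto simp: s_def fun_eq_iff)
    also have "\<dots> \<in> cfun.span (s ` J)"
      using that False by (intro cfun.span_base imageI) (auto simp: J_def)
    finally show ?thesis .
  qed
  have "tensor_square \<eta> \<in> cfun.span (s ` J)" if \<eta>: "\<eta> \<in> V" for \<eta>
  proof -
    obtain c where c: "\<eta> = (\<Sum>i<g. cscale (c i) (e i))"
      using \<eta> unfolding V cfun_span_family[OF finite_lessThan] by (rule rangeE)
    have "tensor_square \<eta> = (\<Sum>i<g. \<Sum>j<g. cscale (c i * c j / 2) (s (i, j)))" (is "_ = ?R")
    proof
      fix w :: "'i \<times> 'i"
      obtain u v where w: "w = (u, v)" by force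
      have prod: "(\<Sum>i<g. c i * e i u) * (\<Sum>j<g. c j * e j v) =
          (\<Sum>i<g. \<Sum>j<g. c i * c j * (e i u * e j v))" for u v
        by (simp add: sum_product mult_ac)
      have "?R w = ((\<Sum>i<g. \<Sum>j<g. c i * c j * (e i u * e j v)) + (\<Sum>i<g. \<Sum>j<g. c i * c j * (e i v * e j u))) / 2"
        by (simp add: w sum_fun_apply cscale_apply s_def sum.distrib sum_divide_distrib add_divide_distrib distrib_left mult.commute)
      also have "\<dots> = (\<Sum>i<g. c i * e i u) * (\<Sum>j<g. c j * e j v)"
        unfolding prod[symmetric] by (simp add: mult.commute)
      finally show "tensor_square \<eta> w = ?R w"
        by (simp add: w c sum_fun_apply cscale_apply)
    qed
    also have "\<dots> \<in> cfun.span (s ` J)"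
      using sJ by (intro cfun.span_sum cfun.span_scale) auto
    finally show ?thesis .
  qed
  moreover have "cfun.subspace V" unfolding V by (rule cfun.subspace_span)
  ultimately have "sym_square V \<subseteq> cfun.span (s ` J)"
    by (simp add: sym_square_eq_span cfun.span_minimal cfun.subspace_span image_subset_iff)
  moreover have "card (s ` J) \<le> g * (g + 1) div 2"
    using card_image_le[OF finJ, of s] cardJ by simp
  ultimately show thesis using that finJ by blast
qed

text \<open>
  If \<open>G k\<close> kills all \<open>Q i\<close> of level \<open>fst i > k\<close> and is injective on the span of those of level \<open>k\<close>,
  then the coefficients of a vanishing combination of the \<open>Q i\<close> are seen to be \<open>0\<close> level by level.
  So the \<open>Q i\<close> are independent, and a bound on the dimension of \<open>D 0\<close> makes them a basis.  The
  same argument, applied to one level at a time, describes the successive kernels.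
\<close>

lemma kernel_filtration:
  fixes D :: "nat \<Rightarrow> ('i \<Rightarrow> complex) set" and G :: "nat \<Rightarrow> ('i \<Rightarrow> complex) \<Rightarrow> 'k \<Rightarrow> complex"
    and Q :: "nat \<times> nat \<Rightarrow> 'i \<Rightarrow> complex"
  assumes D0: "cfun.subspace (D 0)"
    and DS: "\<And>k. D (Suc k) = {x \<in> D k. G k x = 0}"
    and add: "\<And>k x y. x \<in> D 0 \<Longrightarrow> y \<in> D 0 \<Longrightarrow> G k (x + y) = G k x + G k y"
    and scale: "\<And>k a x. x \<in> D 0 \<Longrightarrow> G k (cscale a x) = cscale a (G k x)"
    and I: "finite I" and Q: "\<And>i. i \<in> I \<Longrightarrow> Q i \<in> D 0"
    and kill: "\<And>k i. i \<in> I \<Longrightarrow> k < fst i \<Longrightarrow> G k (Q i) = 0"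
    and lead: "\<And>k a i. (\<Sum>i | i \<in> I \<and> fst i = k. cscale (a i) (G k (Q i))) = 0 \<Longrightarrow>
        i \<in> I \<Longrightarrow> fst i = k \<Longrightarrow> a i = 0"
    and T: "finite T" "card T \<le> card I" "D 0 \<subseteq> cfun.span T"
  shows "D k = cfun.span (Q ` {i \<in> I. k \<le> fst i})"
    and "cfun.dim (D k) = card {i \<in> I. k \<le> fst i}"
    and "cfun.dim (G k ` D k) = card {i \<in> I. fst i = k}"
proof -
  have G0: "G k 0 = 0" for k
    using scale[of 0 k 0] cfun.subspace_0[OF D0] by simp
  have Gsum: "G k (\<Sum>i\<in>J. cscale (a i) (Q i)) = (\<Sum>i\<in>J. cscale (a i) (G k (Q i)))"
    if "J \<subseteq> I" for k J a
    using finite_subset[OF that I] that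
  proof (induction J rule: finite_induct)
    case (insert j J)
    have "cscale (a j) (Q j) \<in> D 0" "(\<Sum>i\<in>J. cscale (a i) (Q i)) \<in> D 0"
      using insert.prems Q by (blast intro: cfun.subspace_scale[OF D0] cfun.subspace_sum[OF D0])+
    moreover have "G k (cscale (a j) (Q j)) = cscale (a j) (G k (Q j))"
      using insert.prems Q by (intro scale) blast
    moreover have "G k (\<Sum>i\<in>J. cscale (a i) (Q i)) = (\<Sum>i\<in>J. cscale (a i) (G k (Q i)))"
      using insert.IH insert.prems by blast
    ultimately have "G k (cscale (a j) (Q j) + (\<Sum>i\<in>J. cscale (a i) (Q i))) =
        cscale (a j) (G k (Q j)) + (\<Sum>i\<in>J. cscale (a i) (G k (Q i)))"
      by (simp add: add)
    then show ?case
      unfolding sum.insert[OF insert.hyps] .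
  qed (simp add: G0)
  \<comment> \<open>Once the levels below \<open>k\<close> are gone, \<open>G k\<close> sees level \<open>k\<close> only.\<close>
  have Glow: "G k (\<Sum>i\<in>I. cscale (a i) (Q i)) = (\<Sum>i | i \<in> I \<and> fst i = k. cscale (a i) (G k (Q i)))"
    if "\<And>i. i \<in> I \<Longrightarrow> fst i < k \<Longrightarrow> a i = 0" for a k
  proof -
    have "(\<Sum>i\<in>I. cscale (a i) (G k (Q i))) = (\<Sum>i | i \<in> I \<and> fst i = k. cscale (a i) (G k (Q i)))"
    proof (rule sum.mono_neutral_right[OF I], blast, rule ballI)
      fix i assume "i \<in> I - {i \<in> I. fst i = k}"
      then consider "i \<in> I" "fst i < k" | "i \<in> I" "k < fst i" by force
      then show "cscale (a i) (G k (Q i)) = 0"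
        by cases (auto simp: that kill)
    qed
    then show ?thesis using Gsum[of I] by simp
  qed
  have ind: "a i = 0" if "(\<Sum>i\<in>I. cscale (a i) (Q i)) = 0" "i \<in> I" for a i
    using that(2)
  proof (induction "fst i" arbitrary: i rule: less_induct)
    case less
    have "G (fst i) (\<Sum>i\<in>I. cscale (a i) (Q i)) = 0" using that(1) G0 by simp
    then show ?case
      using Glow[of "fst i" a] less lead[of a "fst i" i] by auto
  qed
  have dim: "cfun.dim (cfun.span (Q ` J)) = card J" if J: "J \<subseteq> I" for J
  proof (rule cfun_dim_span_family)
    show "finite J" using J I finite_subset by blast
    fix a i assume a: "(\<Sum>i\<in>J. cscale (a i) (Q i)) = 0" and i: "i \<in> J"
    define a' where "a' = (\<lambda>i. if i \<in> J then a i else 0)"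
    have "(\<Sum>i\<in>I. cscale (a' i) (Q i)) = (\<Sum>i\<in>J. cscale (a' i) (Q i))"
      using I J by (intro sum.mono_neutral_right) (auto simp: a'_def)
    also have "\<dots> = 0" using a by (simp add: a'_def)
    finally show "a i = 0" using ind[of a' i] i J by (auto simp: a'_def)
  qed
  have QI: "inj_on Q I" "cfun.independent (Q ` I)"
    by (rule cfun_independent_family[OF I]; use ind in blast)+
  have base: "D 0 = cfun.span (Q ` I)"
  proof
    show "cfun.span (Q ` I) \<subseteq> D 0" using D0 Q by (intro cfun.span_minimal) auto
    show "D 0 \<subseteq> cfun.span (Q ` I)"
    proof (rule subsetI, rule ccontr)
      fix x assume x: "x \<in> D 0" "x \<notin> cfun.span (Q ` I)"
      then have "cfun.independent (insert x (Q ` I))"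
        using QI by (simp add: cfun.independent_insert)
      moreover have "insert x (Q ` I) \<subseteq> cfun.span T" using x T Q by auto
      ultimately have "card (insert x (Q ` I)) \<le> card T"
        using cfun.independent_span_bound[OF T(1)] by blast
      moreover have "x \<notin> Q ` I" using x cfun.span_base by blast
      ultimately show False using T I QI(1) by (simp add: card_image)
    qed
  qed
  show D: "D k = cfun.span (Q ` {i \<in> I. k \<le> fst i})" for k
  proof (induction k)
    case 0
    then show ?case using base by simp
  next
    case (Suc k)
    have D': "D (Suc k) = {x \<in> cfun.span (Q ` {i \<in> I. k \<le> fst i}). G k x = 0}"
      by (simp add: DS Suc)
    have "x \<in> cfun.span (Q ` {i \<in> I. Suc k \<le> fst i})"
      if x: "x \<in> cfun.span (Q ` {i \<in> I. k \<le> fst i})" "G k x = 0" for x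
    proof -
      obtain a where a: "x = (\<Sum>i | i \<in> I \<and> k \<le> fst i. cscale (a i) (Q i))"
        using x(1) I by (subst (asm) cfun_span_family) auto
      define a' where "a' = (\<lambda>i. if k \<le> fst i then a i else 0)"
      have x': "x = (\<Sum>i\<in>I. cscale (a' i) (Q i))"
        unfolding a using I by (intro sum.mono_neutral_cong_left) (auto simp: a'_def)
      have "a' i = 0" if "i \<in> I" "fst i = k" for i
        using Glow[of k a'] x(2) x' lead[of a' k i] that by (simp add: a'_def)
      then have "x = (\<Sum>i | i \<in> I \<and> Suc k \<le> fst i. cscale (a' i) (Q i))"
        unfolding x' using I
      proof (intro sum.mono_neutral_right ballI)
        fix i assume *: "\<And>i. i \<in> I \<Longrightarrow> fst i = k \<Longrightarrow> a' i = 0" "i \<in> I - {i \<in> I. Suc k \<le> fst i}"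
        then consider "fst i = k" "i \<in> I" | "fst i < k" by force
        then show "cscale (a' i) (Q i) = 0" by cases (use * in \<open>auto simp: a'_def\<close>)
      qed auto
      then show ?thesis using I by (subst cfun_span_family) auto
    qed
    moreover have "x \<in> cfun.span (Q ` {i \<in> I. k \<le> fst i}) \<and> G k x = 0"
      if x: "x \<in> cfun.span (Q ` {i \<in> I. Suc k \<le> fst i})" for x
    proof
      show "x \<in> cfun.span (Q ` {i \<in> I. k \<le> fst i})"
        using x cfun.span_mono[of "Q ` {i \<in> I. Suc k \<le> fst i}" "Q ` {i \<in> I. k \<le> fst i}"] by force
      obtain a where "x = (\<Sum>i | i \<in> I \<and> Suc k \<le> fst i. cscale (a i) (Q i))"
        using x I by (subst (asm) cfun_span_family) auto
      then show "G k x = 0" by (subst \<open>x = _\<close>, subst Gsum) (auto simp: kill)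
    qed
    ultimately show ?case unfolding D' by blast
  qed
  show "cfun.dim (D k) = card {i \<in> I. k \<le> fst i}"
    unfolding D by (rule dim) auto
  have "G k ` D k = cfun.span ((\<lambda>i. G k (Q i)) ` {i \<in> I. fst i = k})"
  proof -
    let ?J = "{i \<in> I. k \<le> fst i}" and ?K = "{i \<in> I. fst i = k}"
    have fin: "finite ?J" "finite ?K" using I by auto
    have eq: "G k (\<Sum>i\<in>?J. cscale (a i) (Q i)) = (\<Sum>i\<in>?K. cscale (a i) (G k (Q i)))" for a
    proof -
      have "(\<Sum>i\<in>?J. cscale (a i) (G k (Q i))) = (\<Sum>i\<in>?K. cscale (a i) (G k (Q i)))"
        using I by (intro sum.mono_neutral_right) (auto simp: kill)
      then show ?thesis using Gsum[of ?J] by simp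
    qed
    show ?thesis
      unfolding D cfun_span_family[OF fin(1)] cfun_span_family[OF fin(2)] image_image eq ..
  qed
  then show "cfun.dim (G k ` D k) = card {i \<in> I. fst i = k}"
    using I by (simp only:) (rule cfun_dim_span_family, use lead in auto)
qed

section \<open>Charts and one-forms on a Riemann surface\<close>

lemma chart_inv_in: "z \<in> chart_image c \<Longrightarrow> chart_inv c z \<in> fst c"
  by (auto simp: chart_image_def chart_inv_def intro: inv_into_into)

lemma coord_chart_inv: "z \<in> chart_image c \<Longrightarrow> snd c (chart_inv c z) = z"
  by (auto simp: chart_image_def chart_inv_def f_inv_into_f)

lemma coord_in: "p \<in> fst c \<Longrightarrow> snd c p \<in> chart_image c"
  by (simp add: chart_image_def)

locale riemann_surface =
  fixes X :: "'a topology" and A :: "'a chart set"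
  assumes hausdorff: "Hausdorff_space X" and compact: "compact_space X"
    and atlas: "holomorphic_atlas X A"
begin

lemma chart: "c \<in> A \<Longrightarrow> is_chart X c"
  using atlas by (simp add: holomorphic_atlas_def)

lemma openin_chart: "c \<in> A \<Longrightarrow> openin X (fst c)"
  using chart by (simp add: is_chart_def)

lemma chart_subset: "c \<in> A \<Longrightarrow> fst c \<subseteq> topspace X"
  using openin_chart openin_subset by blast

lemma open_chart_image: "c \<in> A \<Longrightarrow> open (chart_image c)"
  using chart by (simp add: is_chart_def)

lemma homeo_chart: "c \<in> A \<Longrightarrow> homeomorphic_map (subtopology X (fst c)) (top_of_set (chart_image c)) (snd c)"
  using chart by (simp add: is_chart_def)

lemma inj_chart: "c \<in> A \<Longrightarrow> inj_on (snd c) (fst c)"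
  using homeomorphic_imp_injective_map[OF homeo_chart] chart_subset
  by (metis topspace_subtopology_subset)

lemma chart_inv_coord: "c \<in> A \<Longrightarrow> p \<in> fst c \<Longrightarrow> chart_inv c (snd c p) = p"
  using inj_chart by (simp add: chart_inv_def)

lemma obtain_chart:
  assumes "p \<in> topspace X"
  obtains c where "c \<in> A" "p \<in> fst c"
  using assms atlas unfolding holomorphic_atlas_def by blast

lemma chart_at: "p \<in> topspace X \<Longrightarrow> chart_at A p \<in> A \<and> p \<in> fst (chart_at A p)"
  unfolding chart_at_def by (rule someI_ex) (meson obtain_chart)

lemma open_coord_image:
  assumes "c \<in> A" "openin X U"
  shows "open (snd c ` (fst c \<inter> U))"
proof -
  have "openin (subtopology X (fst c)) (fst c \<inter> U)"
    using assms by (metis inf_commute openin_subtopology_Int)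
  then have "openin (top_of_set (chart_image c)) (snd c ` (fst c \<inter> U))"
    using homeomorphic_imp_open_map[OF homeo_chart[OF assms(1)]] unfolding open_map_def by blast
  then show ?thesis using open_chart_image[OF assms(1)] openin_open_trans by blast
qed

lemma openin_coord_vimage:
  assumes "c \<in> A" "open W"
  shows "openin X {p \<in> fst c. snd c p \<in> W}"
proof -
  have "openin (top_of_set (chart_image c)) (chart_image c \<inter> W)"
    using assms(2) by auto
  then have "openin (subtopology X (fst c)) {p \<in> topspace (subtopology X (fst c)). snd c p \<in> chart_image c \<inter> W}"
    using homeomorphic_imp_continuous_map[OF homeo_chart[OF assms(1)]] openin_continuous_map_preimage
    by fastforce
  moreover have "{p \<in> topspace (subtopology X (fst c)). snd c p \<in> chart_image c \<inter> W} = {p \<in> fst c. snd c p \<in> W}"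
    using chart_subset[OF assms(1)] by (auto simp: chart_image_def)
  ultimately show ?thesis
    using openin_chart[OF assms(1)] openin_trans_full by metis
qed

text \<open>
  Transports a property of the punctured neighbourhoods in a chart to the surface.
\<close>

lemma neighbourhood_from_chart:
  assumes "c \<in> A" "p \<in> fst c" and ev: "\<forall>\<^sub>F t in at (snd c p). P t"
  obtains N where "openin X N" "p \<in> N" "N \<subseteq> fst c" "\<And>p'. p' \<in> N - {p} \<Longrightarrow> P (snd c p')"
proof -
  obtain W where W: "open W" "snd c p \<in> W" "\<And>t. t \<in> W \<Longrightarrow> t \<noteq> snd c p \<Longrightarrow> P t"
    using ev unfolding eventually_at_topological by blast
  show thesis
  proof (rule that)
    show "openin X {p \<in> fst c. snd c p \<in> W}" by (rule openin_coord_vimage) fact+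
    show "P (snd c p')" if "p' \<in> {p \<in> fst c. snd c p \<in> W} - {p}" for p'
      using W(3) that inj_chart[OF assms(1)] assms(2) by (auto dest: inj_onD)
  qed (use assms W in auto)
qed

lemma transition_coord:
  "c \<in> A \<Longrightarrow> p \<in> fst c \<Longrightarrow> transition c d (snd c p) = snd d p"
  by (simp add: transition_def chart_inv_coord)

lemma transition_has_derivative:
  assumes "c \<in> A" "d \<in> A" "p \<in> fst c" "p \<in> fst d"
  shows "(transition c d has_field_derivative deriv (transition c d) (snd c p)) (at (snd c p))"
proof (rule holomorphic_derivI)
  show "transition c d holomorphic_on snd c ` (fst c \<inter> fst d)"
    using atlas assms by (auto simp: holomorphic_atlas_def)
  show "open (snd c ` (fst c \<inter> fst d))"
    using assms by (intro open_coord_image openin_chart)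
qed (use assms in auto)

lemma eventually_in_overlap:
  assumes "c \<in> A" "openin X U" "p \<in> fst c" "p \<in> U"
  shows "\<forall>\<^sub>F t in nhds (snd c p). t \<in> snd c ` (fst c \<inter> U)"
  using open_coord_image[OF assms(1,2)] assms by (intro eventually_nhds_in_open) auto

lemma deriv_change_chart:
  assumes cd: "c \<in> A" "d \<in> A" "p \<in> fst c" "p \<in> fst d"
    and F: "(\<lambda>z. F (chart_inv d z)) field_differentiable at (snd d p)"
  shows "deriv (\<lambda>z. F (chart_inv c z)) (snd c p) =
         deriv (\<lambda>z. F (chart_inv d z)) (snd d p) * deriv (transition c d) (snd c p)"
proof -
  have "((\<lambda>z. F (chart_inv d z)) has_field_derivative deriv (\<lambda>z. F (chart_inv d z)) (snd d p))
      (at (transition c d (snd c p)))"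
    using F cd by (simp add: transition_coord field_differentiable_derivI)
  from DERIV_chain2[OF this transition_has_derivative[OF cd]]
  have "((\<lambda>z. F (chart_inv d (transition c d z))) has_field_derivative
      deriv (\<lambda>z. F (chart_inv d z)) (snd d p) * deriv (transition c d) (snd c p)) (at (snd c p))" .
  moreover have "\<forall>\<^sub>F z in nhds (snd c p). F (chart_inv d (transition c d z)) = F (chart_inv c z)"
    using eventually_in_overlap[OF cd(1) openin_chart[OF cd(2)] cd(3,4)]
    by eventually_elim (use cd in \<open>auto simp: transition_coord chart_inv_coord\<close>)
  ultimately have "((\<lambda>z. F (chart_inv c z)) has_field_derivative
      deriv (\<lambda>z. F (chart_inv d z)) (snd d p) * deriv (transition c d) (snd c p)) (at (snd c p))"
    using DERIV_cong_ev by fast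
  then show ?thesis by (rule DERIV_imp_deriv)
qed

text \<open>
  Apply the chain rule to the coordinate function \<open>snd c\<close> itself, whose derivative in the chart \<open>c\<close>
  is \<open>1\<close>.
\<close>

lemma deriv_transition_nonzero:
  assumes cd: "c \<in> A" "d \<in> A" "p \<in> fst c" "p \<in> fst d"
  shows "deriv (transition c d) (snd c p) \<noteq> 0"
proof -
  have "deriv (\<lambda>z. snd d (chart_inv d z)) (snd d p) = 1"
  proof (rule DERIV_imp_deriv)
    have "\<forall>\<^sub>F z in nhds (snd d p). z = snd d (chart_inv d z)"
      using eventually_nhds_in_open[OF open_chart_image[OF cd(2)] coord_in[OF cd(4)]]
      by eventually_elim (simp add: coord_chart_inv)
    from DERIV_cong_ev[OF refl this refl, THEN iffD1, OF DERIV_ident]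
    show "((\<lambda>z. snd d (chart_inv d z)) has_field_derivative 1) (at (snd d p))" .
  qed
  define G where "G = snd c"
  have "(\<lambda>z. G (chart_inv d z)) field_differentiable at (snd d p)"
    using transition_has_derivative[of d c p] cd
    by (auto simp: transition_def o_def G_def field_differentiable_def)
  from deriv_change_chart[OF cd this]
  have "deriv (\<lambda>z. G (chart_inv c z)) (snd c p) =
        deriv (\<lambda>z. G (chart_inv d z)) (snd d p) * deriv (transition c d) (snd c p)" .
  moreover have "deriv (\<lambda>z. G (chart_inv c z)) (snd c p) = 1"
  proof (rule DERIV_imp_deriv)
    have "\<forall>\<^sub>F z in nhds (snd c p). z = G (chart_inv c z)"
      using eventually_nhds_in_open[OF open_chart_image[OF cd(1)] coord_in[OF cd(3)]]
      by eventually_elim (simp add: coord_chart_inv G_def)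
    from DERIV_cong_ev[OF refl this refl, THEN iffD1, OF DERIV_ident]
    show "((\<lambda>z. G (chart_inv c z)) has_field_derivative 1) (at (snd c p))" .
  qed
  ultimately show ?thesis by auto
qed

lemma form_holomorphic:
  "\<eta> \<in> canonical_forms A \<Longrightarrow> c \<in> A \<Longrightarrow> (\<lambda>z. \<eta> (c, z)) holomorphic_on chart_image c"
  by (simp add: canonical_forms_def)

lemma form_change_chart:
  "\<eta> \<in> canonical_forms A \<Longrightarrow> c \<in> A \<Longrightarrow> d \<in> A \<Longrightarrow> p \<in> fst c \<Longrightarrow> p \<in> fst d \<Longrightarrow>
    \<eta> (c, snd c p) = \<eta> (d, snd d p) * deriv (transition c d) (snd c p)"
  unfolding canonical_forms_def by blast

lemma form_outside:
  "\<eta> \<in> canonical_forms A \<Longrightarrow> c \<notin> A \<or> z \<notin> chart_image c \<Longrightarrow> \<eta> (c, z) = 0"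
  unfolding canonical_forms_def by blast

lemma subspace_canonical_forms: "cfun.subspace (canonical_forms A)"
proof (rule cfun.subspaceI)
  show "0 \<in> canonical_forms A" by (simp add: canonical_forms_def)
next
  fix \<eta> \<theta> assume \<eta>: "\<eta> \<in> canonical_forms A" and \<theta>: "\<theta> \<in> canonical_forms A"
  show "\<eta> + \<theta> \<in> canonical_forms A"
    unfolding canonical_forms_def
  proof (intro CollectI conjI ballI allI impI)
    fix c assume "c \<in> A"
    then show "(\<lambda>z. (\<eta> + \<theta>) (c, z)) holomorphic_on chart_image c"
      using form_holomorphic[OF \<eta>] form_holomorphic[OF \<theta>] by (simp add: holomorphic_on_add)
  next
    fix c d p assume "c \<in> A" "d \<in> A" "p \<in> fst c \<inter> fst d"
    then show "(\<eta> + \<theta>) (c, snd c p) = (\<eta> + \<theta>) (d, snd d p) * deriv (transition c d) (snd c p)"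
      by (simp add: distrib_right form_change_chart[OF \<eta>, of c d p] form_change_chart[OF \<theta>, of c d p])
  next
    fix c z assume "c \<notin> A \<or> z \<notin> chart_image c"
    then show "(\<eta> + \<theta>) (c, z) = 0"
      using form_outside[OF \<eta>, of c z] form_outside[OF \<theta>, of c z] by simp
  qed
next
  fix a \<eta> assume \<eta>: "\<eta> \<in> canonical_forms A"
  show "cscale a \<eta> \<in> canonical_forms A"
    unfolding canonical_forms_def
  proof (intro CollectI conjI ballI allI impI)
    fix c assume "c \<in> A"
    then show "(\<lambda>z. cscale a \<eta> (c, z)) holomorphic_on chart_image c"
      using form_holomorphic[OF \<eta>] by (simp add: cscale_apply holomorphic_on_mult)
  next
    fix c d p assume "c \<in> A" "d \<in> A" "p \<in> fst c \<inter> fst d"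
    then show "cscale a \<eta> (c, snd c p) = cscale a \<eta> (d, snd d p) * deriv (transition c d) (snd c p)"
      by (simp add: cscale_apply form_change_chart[OF \<eta>, of c d p])
  next
    fix c z assume "c \<notin> A \<or> z \<notin> chart_image c"
    then show "cscale a \<eta> (c, z) = 0"
      using form_outside[OF \<eta>, of c z] by (simp add: cscale_apply)
  qed
qed

text \<open>
  The value at \<open>p\<close> of the meromorphic function \<open>\<eta>/dF\<close>.  The chart is immaterial, see
  \<open>form_ratio_chart\<close>; at zeros of \<open>dF\<close> the value is \<open>0\<close>, by division by zero.
\<close>

definition form_ratio :: "('a chart \<times> complex \<Rightarrow> complex) \<Rightarrow> ('a \<Rightarrow> complex) \<Rightarrow> 'a \<Rightarrow> complex" where
  "form_ratio \<eta> F p = (let c = chart_at A p in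
     \<eta> (c, snd c p) / deriv (\<lambda>z. F (chart_inv c z)) (snd c p))"

lemma form_ratio_chart:
  assumes \<eta>: "\<eta> \<in> canonical_forms A" and c: "c \<in> A" "p \<in> fst c"
    and F: "(\<lambda>z. F (chart_inv c z)) field_differentiable at (snd c p)"
  shows "form_ratio \<eta> F p = \<eta> (c, snd c p) / deriv (\<lambda>z. F (chart_inv c z)) (snd c p)"
proof -
  have d: "chart_at A p \<in> A" "p \<in> fst (chart_at A p)"
    using chart_at[of p] chart_subset[OF c(1)] c(2) by auto
  show ?thesis
    unfolding form_ratio_def Let_def
    using form_change_chart[OF \<eta> d(1) c(1) d(2) c(2)] deriv_change_chart[OF d(1) c(1) d(2) c(2) F]
      deriv_transition_nonzero[OF d(1) c(1) d(2) c(2)]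
    by simp
qed

end

lemma openin_proj_line_range_Some: "openin proj_line (range Some)"
  unfolding proj_line_def
  using openin_Alexandroff_compactification_image_Some[of euclidean UNIV] by simp

lemma Hausdorff_proj_line: "Hausdorff_space proj_line"
  unfolding proj_line_def
  by (simp add: Hausdorff_space_Alexandroff_compactification locally_compact_space_euclidean)

lemma topspace_proj_line: "topspace proj_line = UNIV"
  unfolding proj_line_def by (auto simp: UNIV_option_conv)

section \<open>Ramification of a double cover of the projective line\<close>

locale double_cover = riemann_surface +
  fixes h :: "'a \<Rightarrow> complex option"
  assumes holomorphic_map: "holomorphic_map X A proj_line proj_line_atlas h"
    and degree: "has_degree X A proj_line proj_line_atlas h 2"
begin

text \<open>
  The cover \<open>h\<close>, read in the two standard charts of the projective line: \<open>x\<close> is meaningful on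
  \<open>x_dom\<close>, that is, off the fibre over infinity, and \<open>w = 1/x\<close> is meaningful on \<open>w_dom\<close>.
\<close>

definition x :: "'a \<Rightarrow> complex" where "x p = the (h p)"

definition w :: "'a \<Rightarrow> complex" where "w p = (case h p of None \<Rightarrow> 0 | Some z \<Rightarrow> 1 / z)"

definition x_dom :: "'a set" where "x_dom = {p \<in> topspace X. h p \<noteq> None}"

definition w_dom :: "'a set" where "w_dom = {p \<in> topspace X. h p \<noteq> Some 0}"

lemma continuous_h: "continuous_map X proj_line h"
  using holomorphic_map by (simp add: holomorphic_map_def)

lemma openin_x_dom: "openin X x_dom"
proof -
  have "x_dom = {p \<in> topspace X. h p \<in> range Some}" by (auto simp: x_dom_def)
  then show ?thesis
    using openin_continuous_map_preimage[OF continuous_h openin_proj_line_range_Some] by simp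
qed

lemma openin_not_value: "openin X {p \<in> topspace X. h p \<noteq> q}"
proof -
  have "openin proj_line (UNIV - {q})"
    using Hausdorff_imp_t1_space[OF Hausdorff_proj_line] topspace_proj_line
    by (metis UNIV_I closedin_def closedin_t1_singleton)
  from openin_continuous_map_preimage[OF continuous_h this] show ?thesis by simp
qed

lemma openin_w_dom: "openin X w_dom"
  unfolding w_dom_def by (rule openin_not_value)

lemma x_holomorphic: 
  assumes "c \<in> A" shows "(\<lambda>z. x (chart_inv c z)) holomorphic_on snd c ` (fst c \<inter> x_dom)"
proof -
  have "(range Some, the) \<in> proj_line_atlas" by (simp add: proj_line_atlas_def)
  then have "(the \<circ> h \<circ> chart_inv c) holomorphic_on snd c ` (fst c \<inter> h -` range Some)"
    using holomorphic_map assms unfolding holomorphic_map_def by fastforce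
  moreover have "fst c \<inter> h -` range Some = fst c \<inter> x_dom"
    using chart_subset[OF assms] by (auto simp: x_dom_def)
  ultimately show ?thesis by (simp add: o_def x_def)
qed

lemma w_holomorphic: 
  assumes "c \<in> A" shows "(\<lambda>z. w (chart_inv c z)) holomorphic_on snd c ` (fst c \<inter> w_dom)"
proof -
  have "(- {Some 0}, \<lambda>q. case q of None \<Rightarrow> 0 | Some z \<Rightarrow> 1 / z) \<in> proj_line_atlas"
    by (simp add: proj_line_atlas_def)
  then have "((\<lambda>q. case q of None \<Rightarrow> 0 | Some z \<Rightarrow> 1 / z) \<circ> h \<circ> chart_inv c)
      holomorphic_on snd c ` (fst c \<inter> h -` (- {Some 0}))"
    using holomorphic_map assms unfolding holomorphic_map_def by fastforce
  moreover have "fst c \<inter> h -` (- {Some 0}) = fst c \<inter> w_dom"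
    using chart_subset[OF assms] by (auto simp: w_dom_def)
  ultimately show ?thesis by (simp add: o_def w_def)
qed

lemma finite_fibre: "finite {p \<in> topspace X. h p = q}"
  using degree topspace_proj_line by (simp add: has_degree_def)

lemma finite_fibre_in_chart:
  assumes "c \<in> A"
  shows "finite {t \<in> chart_image c. h (chart_inv c t) = q}"
proof (rule finite_subset)
  show "{t \<in> chart_image c. h (chart_inv c t) = q} \<subseteq> snd c ` {p \<in> topspace X. h p = q}"
  proof
    fix t assume t: "t \<in> {t \<in> chart_image c. h (chart_inv c t) = q}"
    then have "chart_inv c t \<in> {p \<in> topspace X. h p = q}" "t = snd c (chart_inv c t)"
      using chart_inv_in[of t c] chart_subset[OF assms] by (auto simp: coord_chart_inv)
    then show "t \<in> snd c ` {p \<in> topspace X. h p = q}" by blast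
  qed
  show "finite (snd c ` {p \<in> topspace X. h p = q})" using finite_fibre by blast
qed

text \<open>
  At \<open>p\<close> the function \<open>x - x p\<close> vanishes to an order that is one higher than that of \<open>dx\<close>.  It is not
  locally constant because the fibres are finite.
\<close>

lemma chart_near_x_dom:
  assumes c: "c \<in> A" "p \<in> fst c" "p \<in> x_dom"
  defines "xc \<equiv> \<lambda>z. x (chart_inv c z)"
  shows "\<forall>\<^sub>F t in at (snd c p). t \<in> snd c ` (fst c \<inter> x_dom) \<and> deriv xc t \<noteq> 0"
    and "((\<lambda>t. (xc t - x p) / deriv xc t) \<longlongrightarrow> 0) (at (snd c p))"
proof -
  let ?S = "snd c ` (fst c \<inter> x_dom)"
  define F where "F = (\<lambda>t. xc t - x p)"
  have S: "open ?S" "snd c p \<in> ?S" using c open_coord_image openin_x_dom by auto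
  have hol: "xc holomorphic_on ?S" unfolding xc_def by (rule x_holomorphic[OF c(1)])
  then have Fhol: "F holomorphic_on ?S" unfolding F_def by (intro holomorphic_intros)
  have F0: "F (snd c p) = 0" using c by (simp add: F_def xc_def chart_inv_coord)
  have "{t \<in> ?S. F t = 0} \<subseteq> {t \<in> chart_image c. h (chart_inv c t) = h p}"
    using c by (auto simp: F_def xc_def x_def x_dom_def chart_inv_coord coord_in)
  then have fin: "finite {t \<in> ?S. F t = 0}"
    using finite_fibre_in_chart[OF c(1)] finite_subset by blast
  note Z = zero_over_deriv[OF S(1) Fhol S(2) F0 fin]
  have ev: "\<forall>\<^sub>F t in at (snd c p). t \<in> ?S"
    by (rule eventually_at_in_open'[OF S])
  have dF: "deriv F t = deriv xc t" if "t \<in> ?S" for t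
  proof (rule DERIV_imp_deriv)
    show "(F has_field_derivative deriv xc t) (at t)"
      using holomorphic_derivI[OF hol S(1) that] unfolding F_def
      by (auto intro!: derivative_eq_intros)
  qed
  show "\<forall>\<^sub>F t in at (snd c p). t \<in> ?S \<and> deriv xc t \<noteq> 0"
    using ev Z(1) by eventually_elim (use dF in auto)
  have "\<forall>\<^sub>F t in at (snd c p). F t / deriv F t = (xc t - x p) / deriv xc t"
    using ev by eventually_elim (use dF in \<open>simp add: F_def\<close>)
  with Z(2) show "((\<lambda>t. (xc t - x p) / deriv xc t) \<longlongrightarrow> 0) (at (snd c p))"
    by (rule Lim_transform_eventually)
qed

text \<open>
  Here \<open>dx = - dw/w\<^sup>2\<close>, and \<open>w\<close> vanishes at \<open>p\<close> to a higher order than \<open>dw\<close>.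
\<close>

lemma chart_near_pole:
  assumes c: "c \<in> A" "p \<in> fst c" "h p = None"
  defines "xc \<equiv> \<lambda>z. x (chart_inv c z)"
  shows "\<forall>\<^sub>F t in at (snd c p). t \<in> snd c ` (fst c \<inter> x_dom) \<and> deriv xc t \<noteq> 0"
    and "((\<lambda>t. 1 / deriv xc t) \<longlongrightarrow> 0) (at (snd c p))"
proof -
  let ?S = "snd c ` (fst c \<inter> w_dom)"
  define F where "F = (\<lambda>t. w (chart_inv c t))"
  have p: "p \<in> w_dom" using c chart_subset[OF c(1)] by (auto simp: w_dom_def)
  have S: "open ?S" "snd c p \<in> ?S" using c p open_coord_image openin_w_dom by auto
  have Fhol: "F holomorphic_on ?S" unfolding F_def by (rule w_holomorphic[OF c(1)])
  have F0: "F (snd c p) = 0" using c by (simp add: F_def w_def chart_inv_coord)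
  have "{t \<in> ?S. F t = 0} \<subseteq> {t \<in> chart_image c. h (chart_inv c t) = None}"
    using c by (auto simp: F_def w_def w_dom_def chart_inv_coord coord_in split: option.splits) (metis not_None_eq)+
  then have fin: "finite {t \<in> ?S. F t = 0}"
    using finite_fibre_in_chart[OF c(1)] finite_subset by blast
  note Z = zero_over_deriv[OF S(1) Fhol S(2) F0 fin]
  have ev: "\<forall>\<^sub>F t in at (snd c p). t \<in> ?S"
    by (rule eventually_at_in_open'[OF S])
  have rel: "t \<in> snd c ` (fst c \<inter> x_dom) \<and> xc t = 1 / F t" if "t \<in> ?S" "F t \<noteq> 0" for t
    using that c(1) chart_subset[OF c(1)]
    by (auto simp: F_def xc_def w_def x_def x_dom_def chart_inv_coord w_dom_def split: option.splits)
  have dx: "deriv xc t = - deriv F t / (F t)\<^sup>2" if t: "t \<in> ?S" "F t \<noteq> 0" for t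
  proof (rule DERIV_imp_deriv)
    have "(F has_field_derivative deriv F t) (at t)"
      using Fhol S(1) t by (auto intro: holomorphic_derivI)
    then have D: "((\<lambda>t. 1 / F t) has_field_derivative - deriv F t / (F t)\<^sup>2) (at t)"
      using t by (auto intro!: derivative_eq_intros simp: power2_eq_square)
    have "continuous_on ?S F" using Fhol by (rule holomorphic_on_imp_continuous_on)
    then have "open (?S \<inter> F -` (- {0}))" using S(1) by (intro continuous_open_preimage) auto
    then show "(xc has_field_derivative - deriv F t / (F t)\<^sup>2) (at t)"
      by (rule has_field_derivative_transform_within_open[OF D]) (use t rel in auto)
  qed
  show "\<forall>\<^sub>F t in at (snd c p). t \<in> snd c ` (fst c \<inter> x_dom) \<and> deriv xc t \<noteq> 0"
    using ev Z(1) by eventually_elim (use dx rel in auto)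
  have "isCont F (snd c p)"
    using continuous_on_eq_continuous_at[OF S(1), of F] holomorphic_on_imp_continuous_on[OF Fhol] S(2)
    by blast
  then have "((\<lambda>t. - F t * (F t / deriv F t)) \<longlongrightarrow> - F (snd c p) * 0) (at (snd c p))"
    using Z(2) unfolding isCont_def by (intro tendsto_intros)
  moreover have "\<forall>\<^sub>F t in at (snd c p). - F t * (F t / deriv F t) = 1 / deriv xc t"
    using ev Z(1) by eventually_elim (use dx in \<open>auto simp: power2_eq_square\<close>)
  ultimately show "((\<lambda>t. 1 / deriv xc t) \<longlongrightarrow> 0) (at (snd c p))"
    by (auto intro: Lim_transform_eventually)
qed

text \<open>
  The fibre over infinity is included, whether or not it is ramified: off this set \<open>x\<close> is a
  local coordinate.
\<close>

definition ramification :: "'a set" where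
  "ramification = {p \<in> topspace X. h p = None \<or>
     deriv (\<lambda>z. x (chart_inv (chart_at A p) z)) (snd (chart_at A p) p) = 0}"

lemma x_differentiable:
  assumes "c \<in> A" "p \<in> fst c" "p \<in> x_dom"
  shows "(\<lambda>z. x (chart_inv c z)) field_differentiable at (snd c p)"
  using x_holomorphic[OF assms(1)] open_coord_image[OF assms(1) openin_x_dom] assms
  by (intro holomorphic_on_imp_differentiable_at) auto

lemma not_ramification_iff:
  assumes "c \<in> A" "p \<in> fst c"
  shows "p \<notin> ramification \<longleftrightarrow> p \<in> x_dom \<and> deriv (\<lambda>z. x (chart_inv c z)) (snd c p) \<noteq> 0"
proof (cases "p \<in> x_dom")
  case True
  have d: "chart_at A p \<in> A" "p \<in> fst (chart_at A p)"
    using chart_at[of p] chart_subset[OF assms(1)] assms(2) by auto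
  show ?thesis
    using deriv_change_chart[OF d(1) assms(1) d(2) assms(2) x_differentiable[OF assms True]]
      deriv_transition_nonzero[OF d(1) assms(1) d(2) assms(2)] True
    by (auto simp: ramification_def x_dom_def)
next
  case False
  then show ?thesis using chart_subset[OF assms(1)] assms(2) by (auto simp: ramification_def x_dom_def)
qed

lemma isolated_ramification:
  assumes "p \<in> topspace X"
  obtains N where "openin X N" "p \<in> N" "N \<inter> ramification \<subseteq> {p}"
proof -
  obtain c where c: "c \<in> A" "p \<in> fst c" using assms by (rule obtain_chart)
  have "\<forall>\<^sub>F t in at (snd c p). t \<in> snd c ` (fst c \<inter> x_dom) \<and> deriv (\<lambda>z. x (chart_inv c z)) t \<noteq> 0"
    using chart_near_x_dom[OF c] chart_near_pole[OF c] assms by (cases "h p") (auto simp: x_dom_def)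
  then obtain N where N: "openin X N" "p \<in> N" "N \<subseteq> fst c" 
    "\<And>p'. p' \<in> N - {p} \<Longrightarrow> snd c p' \<in> snd c ` (fst c \<inter> x_dom) \<and> deriv (\<lambda>z. x (chart_inv c z)) (snd c p') \<noteq> 0"
    by (rule neighbourhood_from_chart[OF c]) blast
  have "p' \<notin> ramification" if "p' \<in> N - {p}" for p'
  proof -
    have "p' \<in> x_dom" using N(3) N(4)[OF that] that inj_chart[OF c(1)] by (auto dest: inj_onD)
    then show ?thesis using not_ramification_iff[OF c(1), of p'] N that by blast
  qed
  then show thesis using that[OF N(1,2)] by blast
qed

lemma finite_ramification: "finite ramification"
proof -
  have "\<forall>p\<in>topspace X. \<exists>N. openin X N \<and> p \<in> N \<and> N \<inter> ramification \<subseteq> {p}"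
    using isolated_ramification by metis
  then obtain N where N: "\<And>p. p \<in> topspace X \<Longrightarrow> openin X (N p) \<and> p \<in> N p \<and> N p \<inter> ramification \<subseteq> {p}"
    by metis
  have "\<exists>\<F>. finite \<F> \<and> \<F> \<subseteq> N ` topspace X \<and> topspace X \<subseteq> \<Union> \<F>"
  proof -
    have "\<forall>U\<in>N ` topspace X. openin X U" "topspace X \<subseteq> \<Union> (N ` topspace X)"
      using N by auto
    then show ?thesis using compact unfolding compact_space_alt by metis
  qed
  then obtain \<F> where F: "finite \<F>" "\<F> \<subseteq> N ` topspace X" "topspace X \<subseteq> \<Union> \<F>" by blast
  have "ramification \<subseteq> (\<Union>U\<in>\<F>. U \<inter> ramification)" using F(3) by (auto simp: ramification_def)
  moreover have "finite (U \<inter> ramification)" if "U \<in> \<F>" for U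
    using F(2) that N by (metis finite.emptyI finite_insert finite_subset imageE subsetD)
  ultimately show ?thesis using F(1) by (meson finite_UN_I finite_subset)
qed

text \<open>
  The multiplicity is computed in an unspecified one of the two charts around \<open>h p\<close>; in both of them
  the derivative is nonzero, since \<open>dw = - dx/x\<^sup>2\<close>.
\<close>

lemma map_mult_unramified:
  assumes p: "p \<in> topspace X" "p \<notin> ramification"
  shows "map_mult A proj_line_atlas h p = 1"
proof -
  define c where "c = chart_at A p"
  define d where "d = chart_at proj_line_atlas (h p)"
  have c: "c \<in> A" "p \<in> fst c" using chart_at[OF p(1)] by (auto simp: c_def)
  have px: "p \<in> x_dom" and dx: "deriv (\<lambda>z. x (chart_inv c z)) (snd c p) \<noteq> 0"
    using not_ramification_iff[OF c] p by auto
  have "\<exists>d. d \<in> proj_line_atlas \<and> h p \<in> fst d"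
    using px by (auto simp: proj_line_atlas_def x_dom_def)
  then have "d \<in> proj_line_atlas \<and> h p \<in> fst d"
    unfolding d_def chart_at_def by (rule someI_ex)
  then consider "d = (range Some, the)" 
    | "d = (- {Some 0}, \<lambda>q. case q of None \<Rightarrow> 0 | Some z \<Rightarrow> 1 / z)" "h p \<noteq> Some 0"
    by (auto simp: proj_line_atlas_def)
  then have "zorder (\<lambda>z. snd d (h (chart_inv c z)) - snd d (h p)) (snd c p) = 1"
  proof cases
    case 1
    let ?S = "snd c ` (fst c \<inter> x_dom)"
    have "((\<lambda>z. x (chart_inv c z) - x p) has_field_derivative
        deriv (\<lambda>z. x (chart_inv c z)) (snd c p)) (at (snd c p))"
      using field_differentiable_derivI[OF x_differentiable[OF c px]]
      by (auto intro!: derivative_eq_intros)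
    then have D: "deriv (\<lambda>z. x (chart_inv c z) - x p) (snd c p) = deriv (\<lambda>z. x (chart_inv c z)) (snd c p)"
      by (rule DERIV_imp_deriv)
    have "zorder (\<lambda>z. x (chart_inv c z) - x p) (snd c p) = 1"
    proof (rule zorder_zero_eqI[of _ ?S])
      show "(\<lambda>z. x (chart_inv c z) - x p) holomorphic_on ?S"
        by (intro holomorphic_intros x_holomorphic c)
      show "open ?S" by (rule open_coord_image[OF c(1) openin_x_dom])
    qed (use c px dx D in \<open>auto simp: chart_inv_coord\<close>)
    then show ?thesis using 1 by (simp add: x_def)
  next
    case 2
    let ?S = "snd c ` (fst c \<inter> w_dom)"
    have pw: "p \<in> w_dom" using 2 p by (simp add: w_dom_def)
    have S: "open ?S" by (rule open_coord_image[OF c(1) openin_w_dom])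
    have "((\<lambda>z. 1 / x (chart_inv c z)) has_field_derivative
        - deriv (\<lambda>z. x (chart_inv c z)) (snd c p) / (x p)\<^sup>2) (at (snd c p))"
      using field_differentiable_derivI[OF x_differentiable[OF c px]] 2 px c
      by (auto intro!: derivative_eq_intros simp: chart_inv_coord x_def x_dom_def power2_eq_square)
    moreover have "open (snd c ` (fst c \<inter> (x_dom \<inter> w_dom)))"
      by (intro open_coord_image c openin_Int openin_x_dom openin_w_dom)
    ultimately have "((\<lambda>z. w (chart_inv c z)) has_field_derivative
        - deriv (\<lambda>z. x (chart_inv c z)) (snd c p) / (x p)\<^sup>2) (at (snd c p))"
      by (rule has_field_derivative_transform_within_open)
         (use c px pw in \<open>auto simp: chart_inv_coord x_def w_def x_dom_def\<close>)
    then have "((\<lambda>z. w (chart_inv c z) - w p) has_field_derivative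
        - deriv (\<lambda>z. x (chart_inv c z)) (snd c p) / (x p)\<^sup>2) (at (snd c p))"
      by (auto intro!: derivative_eq_intros)
    then have D: "deriv (\<lambda>z. w (chart_inv c z) - w p) (snd c p) =
        - deriv (\<lambda>z. x (chart_inv c z)) (snd c p) / (x p)\<^sup>2"
      by (rule DERIV_imp_deriv)
    have "x p \<noteq> 0" using 2 px by (auto simp: x_def x_dom_def)
    have "zorder (\<lambda>z. w (chart_inv c z) - w p) (snd c p) = 1"
    proof (rule zorder_zero_eqI[of _ ?S])
      show "(\<lambda>z. w (chart_inv c z) - w p) holomorphic_on ?S"
        by (intro holomorphic_intros w_holomorphic c)
    qed (use c pw dx D S \<open>x p \<noteq> 0\<close> in \<open>auto simp: chart_inv_coord\<close>)
    then show ?thesis using 2 by (simp add: w_def)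
  qed
  then show ?thesis by (simp add: map_mult_def Let_def c_def d_def)
qed

definition branch :: "complex set" where "branch = x ` ramification"

lemma finite_branch: "finite branch"
  unfolding branch_def using finite_ramification by blast

lemma unramified_over:
  "z \<notin> branch \<Longrightarrow> p \<in> topspace X \<Longrightarrow> h p = Some z \<Longrightarrow> p \<notin> ramification"
  by (force simp: branch_def x_def)

text \<open>
  The two points of the fibre, counted with multiplicity, are distinct.
\<close>

lemma card_fibre:
  assumes "z \<notin> branch"
  shows "card {p \<in> topspace X. h p = Some z} = 2"
proof -
  let ?F = "{p \<in> topspace X. h p = Some z}"
  have "int 2 = (\<Sum>p\<in>?F. map_mult A proj_line_atlas h p)"
    using degree topspace_proj_line by (simp add: has_degree_def)
  also have "\<dots> = (\<Sum>p\<in>?F. 1)"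
    by (rule sum.cong) (use assms unramified_over map_mult_unramified in auto)
  finally show ?thesis by simp
qed

end

section \<open>The trace of a one-form\<close>

context double_cover
begin

text \<open>
  The coefficient at \<open>z\<close> of the trace of \<open>\<eta>\<close> along the cover.
\<close>

definition trace :: "('a chart \<times> complex \<Rightarrow> complex) \<Rightarrow> complex \<Rightarrow> complex" where
  "trace \<eta> z = (\<Sum>p | p \<in> topspace X \<and> h p = Some z. form_ratio \<eta> x p)"

text \<open>
  By the inverse function theorem \<open>h\<close> has a holomorphic inverse through each unramified point; along
  it \<open>\<eta>/dx\<close> is a quotient of holomorphic functions with nonvanishing denominator.
\<close>

lemma local_section:
  assumes \<eta>: "\<eta> \<in> canonical_forms A"
    and p: "p \<in> topspace X" "p \<notin> ramification" and N: "openin X N" "p \<in> N"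
  obtains r s where "r > 0" "\<And>z. z \<in> ball (x p) r \<Longrightarrow> s z \<in> N \<and> h (s z) = Some z"
    "(\<lambda>z. form_ratio \<eta> x (s z)) holomorphic_on ball (x p) r"
proof -
  obtain c where c: "c \<in> A" "p \<in> fst c" using p(1) by (rule obtain_chart)
  define xc where "xc = (\<lambda>z. x (chart_inv c z))"
  have px: "p \<in> x_dom" and dx: "deriv xc (snd c p) \<noteq> 0"
    using not_ramification_iff[OF c] p by (auto simp: xc_def)
  define S where "S = snd c ` (fst c \<inter> (x_dom \<inter> N))"
  have S: "open S" "snd c p \<in> S"
    unfolding S_def using c px N openin_x_dom by (auto intro: open_coord_image)
  have hol: "xc holomorphic_on S"
    unfolding xc_def S_def by (rule holomorphic_on_subset[OF x_holomorphic[OF c(1)]]) auto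
  obtain \<rho> where \<rho>: "\<rho> > 0" "ball (snd c p) \<rho> \<subseteq> S" "inj_on xc (ball (snd c p) \<rho>)"
    using has_complex_derivative_locally_injective[OF hol S(2,1) dx] by blast
  let ?B = "ball (snd c p) \<rho>"
  have holB: "xc holomorphic_on ?B" using hol \<rho>(2) holomorphic_on_subset by blast
  obtain f where f: "f holomorphic_on xc ` ?B" "\<And>t. t \<in> ?B \<Longrightarrow> deriv xc t * deriv f (xc t) = 1"
      "\<And>t. t \<in> ?B \<Longrightarrow> f (xc t) = t"
    using holomorphic_has_inverse[OF holB open_ball \<rho>(3)] by blast
  have "open (xc ` ?B)" by (rule open_mapping_thm3[OF holB open_ball \<rho>(3)])
  moreover have "x p \<in> xc ` ?B"
    using \<rho>(1) c by (intro image_eqI[of _ _ "snd c p"]) (auto simp: xc_def chart_inv_coord)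
  ultimately obtain r where r: "r > 0" "ball (x p) r \<subseteq> xc ` ?B"
    using open_contains_ball by blast
  define s where "s = (\<lambda>z. chart_inv c (f z))"
  have key: "f z \<in> ?B \<and> f z \<in> S \<and> xc (f z) = z \<and> s z \<in> fst c \<inter> (x_dom \<inter> N) \<and> snd c (s z) = f z"
    if z: "z \<in> ball (x p) r" for z
  proof -
    obtain t where t: "t \<in> ?B" "z = xc t" using r z by blast
    then have "f z = t" "t \<in> S" using f \<rho>(2) by auto
    moreover have "s z \<in> fst c \<inter> (x_dom \<inter> N) \<and> snd c (s z) = t"
      using \<open>t \<in> S\<close> c(1) \<open>f z = t\<close> by (auto simp: S_def s_def chart_inv_coord)
    ultimately show ?thesis using t by auto
  qed
  show thesis
  proof (rule that[of r s])
    show "r > 0" by fact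
    show "s z \<in> N \<and> h (s z) = Some z" if "z \<in> ball (x p) r" for z
      using key[OF that] by (auto simp: x_dom_def xc_def s_def x_def)
    have "(\<lambda>z. \<eta> (c, f z) / deriv xc (f z)) holomorphic_on ball (x p) r"
    proof -
      have fr: "f holomorphic_on ball (x p) r" using f(1) r(2) holomorphic_on_subset by blast
      have fB: "f ` ball (x p) r \<subseteq> ?B" using key by blast
      have "(\<lambda>t. \<eta> (c, t)) holomorphic_on ?B"
        by (rule holomorphic_on_subset[OF form_holomorphic[OF \<eta> c(1)]])
           (use \<rho>(2) in \<open>auto simp: S_def intro: coord_in\<close>)
      then have "(\<lambda>t. \<eta> (c, t) / deriv xc t) holomorphic_on ?B"
        by (intro holomorphic_intros holB) (use f(2) in force)+
      from holomorphic_on_compose_gen[OF fr this fB] show ?thesis by (simp add: o_def)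
    qed
    moreover have "form_ratio \<eta> x (s z) = \<eta> (c, f z) / deriv xc (f z)" if "z \<in> ball (x p) r" for z
      using form_ratio_chart[OF \<eta> c(1), of "s z" x] key[OF that] x_differentiable[OF c(1), of "s z"]
      by (auto simp: xc_def)
    ultimately show "(\<lambda>z. form_ratio \<eta> x (s z)) holomorphic_on ball (x p) r"
      by (elim holomorphic_transform) (rule sym)
  qed
qed

text \<open>
  Two local sections through the points of the fibre, with values in disjoint open sets, exhaust all
  fibres nearby, because these have only two points.
\<close>

lemma trace_holomorphic:
  assumes \<eta>: "\<eta> \<in> canonical_forms A"
  shows "trace \<eta> holomorphic_on - branch"
proof -
  have op: "open (- branch)" using finite_branch by (simp add: open_Compl finite_imp_closed)
  have "trace \<eta> field_differentiable at z" if z: "z \<notin> branch" for z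
  proof -
    obtain p q where F: "{p \<in> topspace X. h p = Some z} = {p, q}" "p \<noteq> q"
      using card_fibre[OF z] by (meson card_2_iff)
    then have p: "p \<in> topspace X" "h p = Some z" and q: "q \<in> topspace X" "h q = Some z" by auto
    have xpq: "x p = z" "x q = z" using p q by (auto simp: x_def)
    obtain M N where MN: "openin X M" "openin X N" "p \<in> M" "q \<in> N" "disjnt M N"
      using hausdorff p q F(2) unfolding Hausdorff_space_def by meson
    obtain r s where r: "r > 0" "\<And>z'. z' \<in> ball z r \<Longrightarrow> s z' \<in> M \<and> h (s z') = Some z'"
        "(\<lambda>z. form_ratio \<eta> x (s z)) holomorphic_on ball z r"
      using local_section[OF \<eta> p(1) unramified_over[OF z p] MN(1,3)] xpq by metis
    obtain r' s' where r': "r' > 0" "\<And>z'. z' \<in> ball z r' \<Longrightarrow> s' z' \<in> N \<and> h (s' z') = Some z'"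
        "(\<lambda>z. form_ratio \<eta> x (s' z)) holomorphic_on ball z r'"
      using local_section[OF \<eta> q(1) unramified_over[OF z q] MN(2,4)] xpq by metis
    define U where "U = ball z r \<inter> ball z r' \<inter> - branch"
    have U: "open U" "z \<in> U" using op z r r' by (auto simp: U_def)
    have tr: "trace \<eta> z' = form_ratio \<eta> x (s z') + form_ratio \<eta> x (s' z')" if "z' \<in> U" for z'
    proof -
      have s: "s z' \<in> M" "h (s z') = Some z'" "s' z' \<in> N" "h (s' z') = Some z'"
        using r r' that by (auto simp: U_def)
      then have ne: "s z' \<noteq> s' z'" using MN(5) by (auto simp: disjnt_def)
      have "{s z', s' z'} \<subseteq> {p \<in> topspace X. h p = Some z'}"
        using s MN openin_subset by blast
      moreover have "card {s z', s' z'} = card {p \<in> topspace X. h p = Some z'}"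
        using ne card_fibre[of z'] that by (simp add: U_def)
      ultimately have "{s z', s' z'} = {p \<in> topspace X. h p = Some z'}"
        using finite_fibre card_subset_eq by blast
      then have "trace \<eta> z' = sum (form_ratio \<eta> x) {s z', s' z'}" unfolding trace_def by simp
      then show ?thesis using ne by simp
    qed
    have "(\<lambda>z'. form_ratio \<eta> x (s z') + form_ratio \<eta> x (s' z')) holomorphic_on U"
      by (intro holomorphic_on_add; rule holomorphic_on_subset[OF r(3)] holomorphic_on_subset[OF r'(3)])
         (auto simp: U_def)
    then have "trace \<eta> holomorphic_on U" by (rule holomorphic_transform) (rule tr[symmetric])
    then show ?thesis using U by (rule holomorphic_on_imp_differentiable_at)
  qed
  then show ?thesis
    by (simp add: holomorphic_on_def field_differentiable_at_within)
qed

text \<open>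
  A tube lemma: \<open>h\<close> is a closed map, so a neighbourhood of the fibre over \<open>q\<close> contains all fibres over
  a neighbourhood of \<open>q\<close>.
\<close>

lemma fibre_neighbourhood:
  assumes near: "\<And>p. p \<in> topspace X \<Longrightarrow> h p = q \<Longrightarrow> \<exists>N. openin X N \<and> p \<in> N \<and> (\<forall>p'\<in>N - {p}. P p')"
  obtains W where "openin proj_line W" "q \<in> W" "\<And>p. p \<in> topspace X \<Longrightarrow> h p \<in> W \<Longrightarrow> h p \<noteq> q \<Longrightarrow> P p"
proof -
  define F where "F = {p \<in> topspace X. h p = q}"
  have "\<forall>p\<in>F. \<exists>N. openin X N \<and> p \<in> N \<and> (\<forall>p'\<in>N - {p}. P p')"
    using near by (simp add: F_def)
  from bchoice[OF this] obtain N
    where N: "\<And>p. p \<in> F \<Longrightarrow> openin X (N p) \<and> p \<in> N p \<and> (\<forall>p'\<in>N p - {p}. P p')"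
    by auto
  have "openin X (\<Union>p\<in>F. N p)" using N by (intro openin_Union) auto
  then have "closedin X (topspace X - (\<Union>p\<in>F. N p))" by (rule openin_closedin_eq[THEN iffD1, THEN conjunct2])
  then have cl: "closedin proj_line (h ` (topspace X - (\<Union>p\<in>F. N p)))"
    using continuous_imp_closed_map[OF continuous_h compact Hausdorff_proj_line]
    by (simp add: closed_map_def)
  show thesis
  proof (rule that)
    show "openin proj_line (UNIV - h ` (topspace X - (\<Union>p\<in>F. N p)))"
      using cl topspace_proj_line by (metis closedin_def)
    show "q \<in> UNIV - h ` (topspace X - (\<Union>p\<in>F. N p))"
      using N by (auto simp: F_def)
    fix p assume "p \<in> topspace X" "h p \<in> UNIV - h ` (topspace X - (\<Union>p\<in>F. N p))" "h p \<noteq> q"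
    then obtain p' where "p' \<in> F" "p \<in> N p'" "p \<noteq> p'" by (auto simp: F_def)
    then show "P p" using N by blast
  qed
qed

text \<open>
  The growth of the trace at a branch value \<open>q\<close>: combine the local estimate at each point of the
  fibre over \<open>q\<close>.
\<close>

lemma ratio_small_near_finite:
  assumes \<eta>: "\<eta> \<in> canonical_forms A" and e: "\<epsilon> > 0"
  shows "\<forall>\<^sub>F z in at q. \<forall>p\<in>topspace X. h p = Some z \<longrightarrow> norm ((z - q) * form_ratio \<eta> x p) < \<epsilon>"
proof -
  let ?P = "\<lambda>p. norm ((x p - q) * form_ratio \<eta> x p) < \<epsilon>"
  have "\<exists>N. openin X N \<and> p \<in> N \<and> (\<forall>p'\<in>N - {p}. ?P p')" if p: "p \<in> topspace X" "h p = Some q" for p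
  proof -
    obtain c where c: "c \<in> A" "p \<in> fst c" using p(1) by (rule obtain_chart)
    have px: "p \<in> x_dom" "x p = q" using p by (auto simp: x_dom_def x_def)
    define xc where "xc = (\<lambda>z. x (chart_inv c z))"
    have near: "\<forall>\<^sub>F t in at (snd c p). t \<in> snd c ` (fst c \<inter> x_dom) \<and> deriv xc t \<noteq> 0"
      "((\<lambda>t. (xc t - x p) / deriv xc t) \<longlongrightarrow> 0) (at (snd c p))"
      unfolding xc_def by (rule chart_near_x_dom[OF c px(1)])+
    have "isCont (\<lambda>t. \<eta> (c, t)) (snd c p)"
      using continuous_on_eq_continuous_at[OF open_chart_image[OF c(1)]]
        holomorphic_on_imp_continuous_on[OF form_holomorphic[OF \<eta> c(1)]] coord_in[OF c(2)] by blast
    then have "((\<lambda>t. (xc t - x p) / deriv xc t * \<eta> (c, t)) \<longlongrightarrow> 0 * \<eta> (c, snd c p)) (at (snd c p))"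
      unfolding isCont_def by (intro tendsto_mult near(2))
    then have "\<forall>\<^sub>F t in at (snd c p). norm ((xc t - x p) / deriv xc t * \<eta> (c, t)) < \<epsilon>"
      using e by (auto simp: tendsto_iff)
    with near(1) have "\<forall>\<^sub>F t in at (snd c p). t \<in> snd c ` (fst c \<inter> x_dom) \<and>
        norm ((xc t - x p) / deriv xc t * \<eta> (c, t)) < \<epsilon>"
      by eventually_elim auto
    then obtain N where N: "openin X N" "p \<in> N" "N \<subseteq> fst c"
      "\<And>p'. p' \<in> N - {p} \<Longrightarrow> snd c p' \<in> snd c ` (fst c \<inter> x_dom) \<and>
        norm ((xc (snd c p') - x p) / deriv xc (snd c p') * \<eta> (c, snd c p')) < \<epsilon>"
      by (rule neighbourhood_from_chart[OF c]) blast
    have "?P p'" if p': "p' \<in> N - {p}" for p'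
    proof -
      have c': "p' \<in> fst c" using N(3) p' by blast
      then have "p' \<in> x_dom" using N(4)[OF p'] inj_chart[OF c(1)] by (auto dest: inj_onD)
      then show ?thesis
        using N(4)[OF p'] form_ratio_chart[OF \<eta> c(1) c' x_differentiable[OF c(1) c']] px(2)
          chart_inv_coord[OF c(1) c'] by (simp add: xc_def)
    qed
    then show ?thesis using N by blast
  qed
  then obtain W where W: "openin proj_line W" "Some q \<in> W"
      "\<And>p. p \<in> topspace X \<Longrightarrow> h p \<in> W \<Longrightarrow> h p \<noteq> Some q \<Longrightarrow> ?P p"
    using fibre_neighbourhood[of "Some q" ?P] by blast
  have "openin euclidean {z \<in> topspace euclidean. Some z \<in> W}"
    using continuous_map_Some W(1) openin_continuous_map_preimage unfolding proj_line_def by fastforce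
  then have "open {z. Some z \<in> W}" by simp
  then have "\<forall>\<^sub>F z in at q. z \<in> {z. Some z \<in> W} - {q}"
    using W(2) by (intro eventually_at_in_open) auto
  then show ?thesis
  proof eventually_elim
    case (elim z)
    show ?case
    proof (intro ballI impI)
      fix p assume p: "p \<in> topspace X" "h p = Some z"
      then show "norm ((z - q) * form_ratio \<eta> x p) < \<epsilon>"
        using W(3)[of p] elim by (simp add: x_def)
    qed
  qed
qed

text \<open>
  The same at infinity, where \<open>1/dx\<close> tends to \<open>0\<close>.
\<close>

lemma ratio_small_near_infinity:
  assumes \<eta>: "\<eta> \<in> canonical_forms A" and e: "\<epsilon> > 0"
  shows "\<forall>\<^sub>F z in at_infinity. \<forall>p\<in>topspace X. h p = Some z \<longrightarrow> norm (form_ratio \<eta> x p) < \<epsilon>"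
proof -
  let ?P = "\<lambda>p. norm (form_ratio \<eta> x p) < \<epsilon>"
  have "\<exists>N. openin X N \<and> p \<in> N \<and> (\<forall>p'\<in>N - {p}. ?P p')" if p: "p \<in> topspace X" "h p = None" for p
  proof -
    obtain c where c: "c \<in> A" "p \<in> fst c" using p(1) by (rule obtain_chart)
    define xc where "xc = (\<lambda>z. x (chart_inv c z))"
    note near = chart_near_pole[OF c p(2), folded xc_def]
    have "isCont (\<lambda>t. \<eta> (c, t)) (snd c p)"
      using continuous_on_eq_continuous_at[OF open_chart_image[OF c(1)]]
        holomorphic_on_imp_continuous_on[OF form_holomorphic[OF \<eta> c(1)]] coord_in[OF c(2)] by blast
    then have "((\<lambda>t. 1 / deriv xc t * \<eta> (c, t)) \<longlongrightarrow> 0 * \<eta> (c, snd c p)) (at (snd c p))"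
      unfolding isCont_def by (intro tendsto_mult near(2))
    then have "\<forall>\<^sub>F t in at (snd c p). norm (1 / deriv xc t * \<eta> (c, t)) < \<epsilon>"
      using e by (auto simp: tendsto_iff)
    with near(1) have "\<forall>\<^sub>F t in at (snd c p). t \<in> snd c ` (fst c \<inter> x_dom) \<and>
        norm (1 / deriv xc t * \<eta> (c, t)) < \<epsilon>"
      by eventually_elim auto
    then obtain N where N: "openin X N" "p \<in> N" "N \<subseteq> fst c"
      "\<And>p'. p' \<in> N - {p} \<Longrightarrow> snd c p' \<in> snd c ` (fst c \<inter> x_dom) \<and>
        norm (1 / deriv xc (snd c p') * \<eta> (c, snd c p')) < \<epsilon>"
      by (rule neighbourhood_from_chart[OF c]) blast
    have "?P p'" if p': "p' \<in> N - {p}" for p'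
    proof -
      have c': "p' \<in> fst c" using N(3) p' by blast
      then have "p' \<in> x_dom" using N(4)[OF p'] inj_chart[OF c(1)] by (auto dest: inj_onD)
      then show ?thesis
        using N(4)[OF p'] form_ratio_chart[OF \<eta> c(1) c' x_differentiable[OF c(1) c']]
        by (simp add: xc_def)
    qed
    then show ?thesis using N by blast
  qed
  then obtain W where W: "openin proj_line W" "None \<in> W"
      "\<And>p. p \<in> topspace X \<Longrightarrow> h p \<in> W \<Longrightarrow> h p \<noteq> None \<Longrightarrow> ?P p"
    using fibre_neighbourhood[of None ?P] by blast
  obtain C :: "complex set" where C: "compact C" "W = insert None (Some ` (- C))"
    using W(1,2) unfolding proj_line_def openin_Alexandroff_compactification
    by (auto simp: Compl_eq_Diff_UNIV)
  obtain R where R: "\<And>z. z \<in> C \<Longrightarrow> norm z \<le> R"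
    using compact_imp_bounded[OF C(1)] unfolding bounded_iff by blast
  have "\<forall>\<^sub>F z :: complex in at_infinity. R + 1 \<le> norm z"
    unfolding eventually_at_infinity by blast
  then show ?thesis
  proof eventually_elim
    case (elim z)
    then have "z \<notin> C" using R by force
    then show ?case using W(3) C(2) by auto
  qed
qed

lemma norm_trace_bound:
  assumes "z \<notin> branch" "\<And>p. p \<in> topspace X \<Longrightarrow> h p = Some z \<Longrightarrow> norm (a * form_ratio \<eta> x p) < \<epsilon> / 2"
  shows "norm (a * trace \<eta> z) < \<epsilon>"
proof -
  let ?F = "{p \<in> topspace X. h p = Some z}"
  have card: "card ?F = 2" by (rule card_fibre[OF assms(1)])
  have "norm (a * trace \<eta> z) \<le> (\<Sum>p\<in>?F. norm (a * form_ratio \<eta> x p))"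
    unfolding trace_def sum_distrib_left by (rule norm_sum)
  also have "\<dots> < (\<Sum>p\<in>?F. \<epsilon> / 2)"
  proof (rule sum_strict_mono)
    show "?F \<noteq> {}" using card by (metis card.empty zero_neq_numeral)
  qed (use finite_fibre assms(2) in auto)
  also have "\<dots> = \<epsilon>" using card by simp
  finally show ?thesis .
qed

text \<open>
  The trace is a holomorphic one-form on the projective line.  For the hyperelliptic involution this
  says that all one-forms are anti-invariant.
\<close>

lemma trace_eq_0:
  assumes \<eta>: "\<eta> \<in> canonical_forms A" and z: "z \<notin> branch"
  shows "trace \<eta> z = 0"
proof (rule holomorphic_vanishing_at_infinity[OF finite_branch trace_holomorphic[OF \<eta>] _ _ z])
  fix b assume "b \<in> branch"
  have "open (- (branch - {b}))"
    by (intro open_Compl finite_imp_closed finite_Diff finite_branch)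
  then have ev: "\<forall>\<^sub>F z in at b. z \<in> - (branch - {b}) - {b}"
    by (intro eventually_at_in_open) auto
  show "((\<lambda>z. (z - b) * trace \<eta> z) \<longlongrightarrow> 0) (at b)"
  proof (rule tendstoI)
    fix \<epsilon> :: real assume "\<epsilon> > 0"
    then have "\<epsilon> / 2 > 0" by simp
    from ratio_small_near_finite[OF \<eta> this, of b] ev
    show "\<forall>\<^sub>F z in at b. dist ((z - b) * trace \<eta> z) 0 < \<epsilon>"
    proof eventually_elim
      case (elim z)
      have "norm ((z - b) * trace \<eta> z) < \<epsilon>"
        by (rule norm_trace_bound) (use elim in auto)
      then show ?case by (simp only: dist_0_norm dist_commute[of _ 0])
    qed
  qed
next
  show "(trace \<eta> \<longlongrightarrow> 0) at_infinity"
  proof (rule tendstoI)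
    fix \<epsilon> :: real assume "\<epsilon> > 0"
    then have "\<epsilon> / 2 > 0" by simp
    have "\<forall>\<^sub>F z in at_infinity. z \<notin> branch"
    proof -
      obtain R where R: "\<And>z. z \<in> branch \<Longrightarrow> norm z \<le> R"
        using finite_imp_bounded[OF finite_branch] unfolding bounded_iff by blast
      have "\<forall>\<^sub>F z :: complex in at_infinity. R + 1 \<le> norm z"
        unfolding eventually_at_infinity by blast
      then show ?thesis by eventually_elim (use R in force)
    qed
    with ratio_small_near_infinity[OF \<eta> \<open>\<epsilon> / 2 > 0\<close>]
    show "\<forall>\<^sub>F z in at_infinity. dist (trace \<eta> z) 0 < \<epsilon>"
    proof eventually_elim
      case (elim z)
      have "norm (1 * trace \<eta> z) < \<epsilon>"
        by (rule norm_trace_bound) (use elim in auto)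
      then show ?case by (simp only: dist_0_norm dist_commute[of _ 0] mult_1)
    qed
  qed
qed

end

section \<open>A function with two simple poles\<close>

text \<open>
  A value that is not a branch value exists because there are only finitely many branch values.
\<close>

locale unramified_value = double_cover +
  fixes a :: complex and p1 p2 :: 'a
  assumes unramified: "a \<notin> branch"
    and fibre_a: "{p \<in> topspace X. h p = Some a} = {p1, p2}" and distinct: "p1 \<noteq> p2"
begin

text \<open>
  The cover followed by the automorphism of the projective line that moves \<open>a\<close> to infinity.  At the
  poles \<open>p1\<close> and \<open>p2\<close> the value is \<open>0\<close>, by division by zero.
\<close>

definition u :: "'a \<Rightarrow> complex" where
  "u p = (case h p of None \<Rightarrow> 0 | Some z \<Rightarrow> 1 / (z - a))"

definition u_dom :: "'a set" where "u_dom = {p \<in> topspace X. h p \<noteq> Some a}"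

lemma openin_u_dom: "openin X u_dom"
  unfolding u_dom_def by (rule openin_not_value)

lemma u_dom_iff: "p \<in> topspace X \<Longrightarrow> p \<in> u_dom \<longleftrightarrow> p \<notin> {p1, p2}"
  using fibre_a by (auto simp: u_dom_def)

lemma chart_image_poles:
  assumes "c \<in> A"
  shows "snd c ` (fst c \<inter> u_dom) = chart_image c - snd c ` (fst c \<inter> {p1, p2})"
proof -
  have "fst c \<inter> u_dom = fst c - fst c \<inter> {p1, p2}"
    using u_dom_iff chart_subset[OF assms] by blast
  then have "snd c ` (fst c \<inter> u_dom) = snd c ` fst c - snd c ` (fst c \<inter> {p1, p2})"
    using inj_on_image_set_diff[OF inj_chart[OF assms], of "fst c" "fst c \<inter> {p1, p2}"] by auto
  then show ?thesis by (simp add: chart_image_def)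
qed

text \<open>
  All the identities below are first checked where \<open>u\<close> is finite; they extend by continuity.
\<close>

lemma eq_off_poles:
  fixes f g :: "complex \<Rightarrow> complex"
  assumes c: "c \<in> A" and "continuous_on (chart_image c) f" "continuous_on (chart_image c) g"
    and eq: "\<And>p. p \<in> fst c \<Longrightarrow> p \<in> u_dom \<Longrightarrow> f (snd c p) = g (snd c p)" and z: "z \<in> chart_image c"
  shows "f z = g z"
proof (rule continuous_eq_off_finite[OF open_chart_image[OF c] _ assms(2,3) _ z])
  show "finite (snd c ` (fst c \<inter> {p1, p2}))" by simp
  show "f t = g t" if "t \<in> chart_image c - snd c ` (fst c \<inter> {p1, p2})" for t
    using that eq unfolding chart_image_poles[OF c, symmetric] by auto
qed

lemma form_eq_off_poles:
  assumes "\<eta> \<in> canonical_forms A" "\<theta> \<in> canonical_forms A"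
    and eq: "\<And>c p. c \<in> A \<Longrightarrow> p \<in> fst c \<Longrightarrow> p \<in> u_dom \<Longrightarrow> \<eta> (c, snd c p) = \<theta> (c, snd c p)"
  shows "\<eta> = \<theta>"
proof
  fix cz :: "'a chart \<times> complex"
  obtain c z where cz: "cz = (c, z)" by (cases cz)
  show "\<eta> cz = \<theta> cz"
  proof (cases "c \<in> A \<and> z \<in> chart_image c")
    case True
    then have c: "c \<in> A" "z \<in> chart_image c" by auto
    have "continuous_on (chart_image c) (\<lambda>z. \<eta> (c, z))" "continuous_on (chart_image c) (\<lambda>z. \<theta> (c, z))"
      using assms(1,2) form_holomorphic c(1) holomorphic_on_imp_continuous_on by blast+
    from eq_off_poles[OF c(1) this eq[OF c(1)] c(2)] show ?thesis unfolding cz .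
  next
    case False
    then show ?thesis
      unfolding cz using form_outside[OF assms(1), of c z] form_outside[OF assms(2), of c z] by auto
  qed
qed

text \<open>
  Off the fibre over infinity \<open>u = 1/(x - a)\<close>, and off the fibre over \<open>0\<close> also \<open>u = w/(1 - a w)\<close>.
\<close>

lemma u_holomorphic:
  assumes c: "c \<in> A"
  shows "(\<lambda>z. u (chart_inv c z)) holomorphic_on snd c ` (fst c \<inter> u_dom)"
proof -
  let ?S1 = "snd c ` (fst c \<inter> (x_dom \<inter> u_dom))" and ?S2 = "snd c ` (fst c \<inter> (w_dom \<inter> u_dom))"
  have "(\<lambda>z. 1 / (x (chart_inv c z) - a)) holomorphic_on ?S1"
  proof (intro holomorphic_intros)
    show "(\<lambda>z. x (chart_inv c z)) holomorphic_on ?S1"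
      by (rule holomorphic_on_subset[OF x_holomorphic[OF c]]) auto
  qed (use c in \<open>auto simp: chart_inv_coord x_dom_def u_dom_def x_def\<close>)
  then have 1: "(\<lambda>z. u (chart_inv c z)) holomorphic_on ?S1"
    by (rule holomorphic_transform) (use c in \<open>auto simp: chart_inv_coord x_dom_def x_def u_def\<close>)
  have "(\<lambda>z. w (chart_inv c z) / (1 - a * w (chart_inv c z))) holomorphic_on ?S2"
  proof (intro holomorphic_intros)
    show "(\<lambda>z. w (chart_inv c z)) holomorphic_on ?S2"
      by (rule holomorphic_on_subset[OF w_holomorphic[OF c]]) auto
    then show "(\<lambda>z. w (chart_inv c z)) holomorphic_on ?S2" .
  qed (use c in \<open>auto simp: chart_inv_coord w_dom_def u_dom_def w_def split: option.splits\<close>)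
  then have 2: "(\<lambda>z. u (chart_inv c z)) holomorphic_on ?S2"
    by (rule holomorphic_transform)
      (use c in \<open>auto simp: chart_inv_coord w_dom_def u_dom_def w_def u_def field_simps split: option.splits\<close>)
  have "(\<lambda>z. u (chart_inv c z)) holomorphic_on ?S1 \<union> ?S2"
    using 1 2 by (rule holomorphic_on_Un) (auto intro!: open_coord_image c openin_Int openin_x_dom openin_w_dom openin_u_dom)
  moreover have "?S1 \<union> ?S2 = snd c ` (fst c \<inter> u_dom)"
    by (auto simp: x_dom_def w_dom_def u_dom_def)
  ultimately show ?thesis by simp
qed

lemma finite_fibre_u: "finite {p \<in> u_dom. u p = y}"
proof (rule finite_subset)
  show "{p \<in> u_dom. u p = y} \<subseteq> {p \<in> topspace X. h p = None} \<union> {p \<in> topspace X. h p = Some (a + 1 / y)}"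
    by (auto simp: u_dom_def u_def field_simps split: option.splits)
qed (use finite_fibre in blast)

lemma pole_x: "p \<in> {p1, p2} \<Longrightarrow> p \<in> topspace X \<and> p \<in> x_dom \<and> x p = a \<and> p \<notin> ramification"
proof -
  assume "p \<in> {p1, p2}"
  then have "p \<in> topspace X \<and> h p = Some a" unfolding fibre_a[symmetric] by simp
  then show ?thesis using unramified_over[OF unramified] by (simp add: x_dom_def x_def)
qed

text \<open>
  The trace at \<open>a\<close> has only two summands, so one vanishes if the other does.
\<close>

lemma vanishes_at_both_poles:
  assumes \<eta>: "\<eta> \<in> canonical_forms A"
    and c: "c \<in> A" "p1 \<in> fst c" "\<eta> (c, snd c p1) = 0"
    and d: "d \<in> A" "p \<in> fst d" "p \<in> {p1, p2}"
  shows "\<eta> (d, snd d p) = 0"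
proof -
  have "form_ratio \<eta> x p1 + form_ratio \<eta> x p2 = trace \<eta> a"
    unfolding trace_def fibre_a using distinct by simp
  then have sum: "form_ratio \<eta> x p1 + form_ratio \<eta> x p2 = 0"
    using trace_eq_0[OF \<eta> unramified] by simp
  have "form_ratio \<eta> x p1 = 0"
    using form_ratio_chart[OF \<eta> c(1,2) x_differentiable[OF c(1,2)]] pole_x[of p1] c(3) by simp
  then have "form_ratio \<eta> x p = 0" using sum d(3) by auto
  moreover have "deriv (\<lambda>z. x (chart_inv d z)) (snd d p) \<noteq> 0"
    using not_ramification_iff[OF d(1,2)] pole_x[OF d(3)] by blast
  ultimately show ?thesis
    using form_ratio_chart[OF \<eta> d(1,2) x_differentiable[OF d(1,2)]] pole_x[OF d(3)] by auto
qed

text \<open>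
  The zeros of \<open>\<eta>\<close> cancel the simple poles of \<open>u\<close>.  At the poles the value of \<open>u \<eta>\<close> is given by
  l'Hopital's rule, and the transformation law there follows by continuity.
\<close>

lemma ex_form_times_u:
  assumes \<eta>: "\<eta> \<in> canonical_forms A"
    and zero: "\<And>c p. c \<in> A \<Longrightarrow> p \<in> fst c \<Longrightarrow> p \<in> {p1, p2} \<Longrightarrow> \<eta> (c, snd c p) = 0"
  shows "\<exists>\<theta>\<in>canonical_forms A. \<forall>c\<in>A. \<forall>p\<in>fst c \<inter> u_dom. \<theta> (c, snd c p) = u p * \<eta> (c, snd c p)"
proof -
  define \<theta> :: "'a chart \<times> complex \<Rightarrow> complex" where
    "\<theta> = (\<lambda>(c, z). if c \<in> A \<and> z \<in> chart_image c then
        (if chart_inv c z \<in> u_dom then u (chart_inv c z) * \<eta> (c, z)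
         else deriv (\<lambda>t. \<eta> (c, t)) z / deriv (\<lambda>t. x (chart_inv c t)) z) else 0)"
  have off: "\<theta> (c, snd c p) = u p * \<eta> (c, snd c p)" if "c \<in> A" "p \<in> fst c" "p \<in> u_dom" for c p
    using that by (simp add: \<theta>_def chart_inv_coord coord_in)
  have hol: "(\<lambda>z. \<theta> (c, z)) holomorphic_on chart_image c" if c: "c \<in> A" for c
  proof (rule no_isolated_singularity'[OF _ _ open_chart_image[OF c]])
    show "finite (snd c ` (fst c \<inter> {p1, p2}))" by simp
    have "(\<lambda>z. u (chart_inv c z) * \<eta> (c, z)) holomorphic_on snd c ` (fst c \<inter> u_dom)"
      by (intro holomorphic_intros u_holomorphic[OF c] holomorphic_on_subset[OF form_holomorphic[OF \<eta> c]])
        (auto simp: coord_in)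
    then have "(\<lambda>z. \<theta> (c, z)) holomorphic_on snd c ` (fst c \<inter> u_dom)"
      by (rule holomorphic_transform) (use c in \<open>auto simp: off[OF c] chart_inv_coord[OF c]\<close>)
    then show "(\<lambda>z. \<theta> (c, z)) holomorphic_on chart_image c - snd c ` (fst c \<inter> {p1, p2})"
      by (simp only: chart_image_poles[OF c])
  next
    fix z assume "z \<in> snd c ` (fst c \<inter> {p1, p2})"
    then obtain p where p: "p \<in> fst c" "p \<in> {p1, p2}" "z = snd c p" by blast
    note px = pole_x[OF p(2)]
    define xc where "xc = (\<lambda>t. x (chart_inv c t))"
    have nz: "deriv xc z \<noteq> 0" using px not_ramification_iff[OF c p(1)] by (simp add: xc_def p)
    have "(xc has_field_derivative deriv xc z) (at z)"
      using x_differentiable[OF c p(1)] px by (simp add: field_differentiable_derivI xc_def p)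
    then have dv: "((\<lambda>t. xc t - a) has_field_derivative deriv xc z) (at z)"
      by (auto intro!: derivative_eq_intros)
    have d\<eta>: "((\<lambda>t. \<eta> (c, t)) has_field_derivative deriv (\<lambda>t. \<eta> (c, t)) z) (at z)"
      unfolding p(3) by (rule holomorphic_derivI[OF form_holomorphic[OF \<eta> c] open_chart_image[OF c] coord_in[OF p(1)]])
    have v0: "xc z - a = 0" "\<eta> (c, z) = 0"
      using px zero[OF c p(1,2)] p c by (auto simp: xc_def chart_inv_coord)
    have lim: "((\<lambda>t. \<eta> (c, t) / (xc t - a)) \<longlongrightarrow> deriv (\<lambda>t. \<eta> (c, t)) z / deriv xc z) (at z)"
      by (rule quotient_at_simple_zero[OF d\<eta> dv v0(2,1) nz])
    have "((\<lambda>t. (xc t - a) / (t - z)) \<longlongrightarrow> deriv xc z) (at z)"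
      using dv v0 unfolding has_field_derivative_iff by simp
    then have ne: "\<forall>\<^sub>F t in at z. (xc t - a) / (t - z) \<noteq> 0"
      using nz by (rule tendsto_imp_eventually_ne)
    have "\<forall>\<^sub>F t in at z. t \<in> snd c ` (fst c \<inter> x_dom)"
      by (rule eventually_at_in_open') (use p px c openin_x_dom in \<open>auto intro!: open_coord_image\<close>)
    with ne have "\<forall>\<^sub>F t in at z. \<eta> (c, t) / (xc t - a) = \<theta> (c, t)"
    proof eventually_elim
      case (elim t)
      then obtain q where q: "q \<in> fst c" "q \<in> x_dom" "t = snd c q" by blast
      have "x q \<noteq> a" using elim(1) q c by (auto simp: xc_def chart_inv_coord)
      then have "q \<in> u_dom" "u q = 1 / (x q - a)"
        using q(2) by (auto simp: x_dom_def x_def u_dom_def u_def)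
      then show ?case using off[OF c q(1)] q c by (simp add: xc_def chart_inv_coord)
    qed
    with lim have "((\<lambda>t. \<theta> (c, t)) \<longlongrightarrow> deriv (\<lambda>t. \<eta> (c, t)) z / deriv xc z) (at z)"
      by (rule Lim_transform_eventually)
    moreover have "\<theta> (c, z) = deriv (\<lambda>t. \<eta> (c, t)) z / deriv xc z"
      using p c u_dom_iff[of p] px by (simp add: \<theta>_def xc_def chart_inv_coord coord_in)
    ultimately show "((\<lambda>t. \<theta> (c, t)) \<longlongrightarrow> \<theta> (c, z)) (at z within chart_image c)"
      using tendsto_within_subset[OF _ subset_UNIV] by metis
  qed
  have change: "\<theta> (c, snd c p) = \<theta> (d, snd d p) * deriv (transition c d) (snd c p)"
    if cd: "c \<in> A" "d \<in> A" and p: "p \<in> fst c \<inter> fst d" for c d p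
  proof -
    let ?O = "snd c ` (fst c \<inter> fst d)"
    have O: "open ?O" by (rule open_coord_image[OF cd(1) openin_chart[OF cd(2)]])
    have tr: "transition c d holomorphic_on ?O"
      using atlas cd by (auto simp: holomorphic_atlas_def)
    have "(\<lambda>t. \<theta> (c, t)) holomorphic_on ?O"
      by (rule holomorphic_on_subset[OF hol[OF cd(1)]]) (auto simp: coord_in)
    then have c1: "continuous_on ?O (\<lambda>t. \<theta> (c, t))" by (rule holomorphic_on_imp_continuous_on)
    have "(\<lambda>t. \<theta> (d, transition c d t)) holomorphic_on ?O"
    proof -
      have "transition c d ` ?O \<subseteq> chart_image d"
        using cd(1) by (auto simp: transition_coord[OF cd(1)] intro: coord_in)
      from holomorphic_on_compose_gen[OF tr hol[OF cd(2)] this] show ?thesis by (simp add: o_def)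
    qed
    then have "(\<lambda>t. \<theta> (d, transition c d t) * deriv (transition c d) t) holomorphic_on ?O"
      using tr O by (intro holomorphic_intros)
    then have c2: "continuous_on ?O (\<lambda>t. \<theta> (d, transition c d t) * deriv (transition c d) t)"
      by (rule holomorphic_on_imp_continuous_on)
    have eq: "\<theta> (c, t) = \<theta> (d, transition c d t) * deriv (transition c d) t"
      if t: "t \<in> ?O - snd c ` {p1, p2}" for t
    proof -
      obtain q where q: "q \<in> fst c" "q \<in> fst d" "t = snd c q" "q \<notin> {p1, p2}" using t by blast
      then have "q \<in> u_dom" using u_dom_iff chart_subset[OF cd(1)] by blast
      then show ?thesis
        using off[OF cd(1) q(1)] off[OF cd(2) q(2)] form_change_chart[OF \<eta> cd q(1,2)] q(3)
          transition_coord[OF cd(1) q(1)] by simp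
    qed
    have fin: "finite (snd c ` {p1, p2})" by simp
    have "\<theta> (c, snd c p) = \<theta> (d, transition c d (snd c p)) * deriv (transition c d) (snd c p)"
      by (rule continuous_eq_off_finite[OF O fin c1 c2 eq]) (use p in auto)
    then show ?thesis using transition_coord[OF cd(1)] p by simp
  qed
  have "\<theta> \<in> canonical_forms A"
    unfolding canonical_forms_def
  proof (intro CollectI conjI ballI allI impI)
    show "\<theta> (c, z) = 0" if "c \<notin> A \<or> z \<notin> chart_image c" for c z
      using that by (auto simp: \<theta>_def)
  qed (use hol change in blast)+
  then show ?thesis using off by blast
qed

end

section \<open>The canonical system of a hyperelliptic curve\<close>

context unramified_value
begin

lemma infinite_image_u:
  assumes c: "c \<in> A" and U: "open U" "U \<noteq> {}" "U \<subseteq> snd c ` (fst c \<inter> u_dom)"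
  shows "infinite ((\<lambda>t. u (chart_inv c t)) ` U)"
proof
  assume fin: "finite ((\<lambda>t. u (chart_inv c t)) ` U)"
  have "U \<subseteq> (\<Union>y\<in>(\<lambda>t. u (chart_inv c t)) ` U. snd c ` {p \<in> u_dom. u p = y})"
  proof
    fix t assume t: "t \<in> U"
    then obtain p where p: "p \<in> fst c" "p \<in> u_dom" "t = snd c p" using U(3) by blast
    then have "t \<in> snd c ` {p' \<in> u_dom. u p' = u (chart_inv c t)}"
      using chart_inv_coord[OF c p(1)] by auto
    then show "t \<in> (\<Union>y\<in>(\<lambda>t. u (chart_inv c t)) ` U. snd c ` {p \<in> u_dom. u p = y})"
      using t by blast
  qed
  then have "finite U"
    by (rule finite_subset) (intro finite_UN_I fin finite_imageI finite_fibre_u)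
  then show False using U open_infinite_complex by blast
qed

text \<open>
  An open set of a chart on which \<open>\<omega>\<close> has no zeros and \<open>u\<close> is a local coordinate.  Since \<open>u\<close> takes
  infinitely many values there, it detects polynomials in \<open>u\<close>.
\<close>

lemma generic_open_set:
  assumes \<omega>: "\<omega> \<in> canonical_forms A" "\<omega> \<noteq> 0"
  obtains c U where "c \<in> A" "open U" "U \<noteq> {}" "U \<subseteq> snd c ` (fst c \<inter> u_dom)"
    "\<And>t. t \<in> U \<Longrightarrow> \<omega> (c, t) \<noteq> 0" "\<And>t. t \<in> U \<Longrightarrow> deriv (\<lambda>t. u (chart_inv c t)) t \<noteq> 0"
proof -
  have "\<exists>c\<in>A. \<exists>p\<in>fst c \<inter> u_dom. \<omega> (c, snd c p) \<noteq> 0"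
  proof (rule ccontr)
    assume "\<not> ?thesis"
    then have "\<omega> = 0"
      using cfun.subspace_0[OF subspace_canonical_forms] by (intro form_eq_off_poles[OF \<omega>(1)]) auto
    with \<omega>(2) show False ..
  qed
  then obtain c p where c: "c \<in> A" and p: "p \<in> fst c" "p \<in> u_dom" "\<omega> (c, snd c p) \<noteq> 0" by blast
  define S where "S = snd c ` (fst c \<inter> u_dom)"
  define uc where "uc = (\<lambda>t. u (chart_inv c t))"
  have S: "open S" unfolding S_def by (rule open_coord_image[OF c openin_u_dom])
  have "(\<lambda>t. \<omega> (c, t)) holomorphic_on S"
    by (rule holomorphic_on_subset[OF form_holomorphic[OF \<omega>(1) c]]) (auto simp: S_def coord_in)
  then have "open (S \<inter> (\<lambda>t. \<omega> (c, t)) -` (- {0}))"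
    by (intro continuous_open_preimage holomorphic_on_imp_continuous_on S) auto
  moreover have "snd c p \<in> S \<inter> (\<lambda>t. \<omega> (c, t)) -` (- {0})" using p by (auto simp: S_def)
  ultimately obtain r where r: "r > 0" "ball (snd c p) r \<subseteq> S \<inter> (\<lambda>t. \<omega> (c, t)) -` (- {0})"
    using open_contains_ball by metis
  have hol: "uc holomorphic_on ball (snd c p) r"
    unfolding uc_def by (rule holomorphic_on_subset[OF u_holomorphic[OF c]]) (use r in \<open>auto simp: S_def\<close>)
  have "\<exists>t\<in>ball (snd c p) r. deriv uc t \<noteq> 0"
  proof (rule ccontr)
    assume *: "\<not> ?thesis"
    have "uc constant_on ball (snd c p) r"
    proof (rule has_field_derivative_0_imp_constant_on)
      show "(uc has_field_derivative 0) (at t)" if "t \<in> ball (snd c p) r" for t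
        using holomorphic_derivI[OF hol open_ball that] * that by simp
    qed auto
    then have "finite (uc ` ball (snd c p) r)"
      by (auto simp: constant_on_def image_def intro: finite_subset[of _ "{_}"])
    then show False
      using infinite_image_u[OF c open_ball, of "snd c p" r] r by (auto simp: uc_def S_def)
  qed
  then obtain t where t: "t \<in> ball (snd c p) r" "deriv uc t \<noteq> 0" by blast
  show thesis
  proof (rule that[OF c])
    show "open (ball (snd c p) r \<inter> deriv uc -` (- {0}))"
      by (intro continuous_open_preimage holomorphic_on_imp_continuous_on holomorphic_deriv hol) auto
    show "ball (snd c p) r \<inter> deriv uc -` (- {0}) \<noteq> {}" using t by blast
    show "ball (snd c p) r \<inter> deriv uc -` (- {0}) \<subseteq> snd c ` (fst c \<inter> u_dom)" using r by (auto simp: S_def)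
  qed (use r in \<open>auto simp: uc_def\<close>)
qed

text \<open>
  \<open>\<eta> = u\<^sup>m \<omega>\<close>, where \<open>\<eta>\<close> is holomorphic also at the poles of \<open>u\<close>.
\<close>

definition power_multiple :: "nat \<Rightarrow> ('a chart \<times> complex \<Rightarrow> complex) \<Rightarrow> ('a chart \<times> complex \<Rightarrow> complex) \<Rightarrow> bool" where
  "power_multiple m \<omega> \<eta> \<longleftrightarrow> \<eta> \<in> canonical_forms A \<and>
     (\<forall>c\<in>A. \<forall>p\<in>fst c \<inter> u_dom. \<eta> (c, snd c p) = u p ^ m * \<omega> (c, snd c p))"

lemma power_multiple_form: "power_multiple m \<omega> \<eta> \<Longrightarrow> \<eta> \<in> canonical_forms A"
  by (simp add: power_multiple_def)

lemma power_multiple_apply: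
  "power_multiple m \<omega> \<eta> \<Longrightarrow> c \<in> A \<Longrightarrow> p \<in> fst c \<Longrightarrow> p \<in> u_dom \<Longrightarrow>
    \<eta> (c, snd c p) = u p ^ m * \<omega> (c, snd c p)"
  by (simp add: power_multiple_def)

lemma power_multiple_0: "\<omega> \<in> canonical_forms A \<Longrightarrow> power_multiple 0 \<omega> \<omega>"
  by (simp add: power_multiple_def)

lemma power_multiple_diff:
  assumes "power_multiple m \<omega> \<eta>" "power_multiple m \<omega>' \<eta>'"
  shows "power_multiple m (\<omega> - cscale b \<omega>') (\<eta> - cscale b \<eta>')"
  using assms cfun.subspace_diff[OF subspace_canonical_forms] cfun.subspace_scale[OF subspace_canonical_forms]
  by (simp add: power_multiple_def cscale_apply algebra_simps)

lemma poly_multiple_eq_0: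
  assumes \<omega>: "\<omega> \<in> canonical_forms A" "\<omega> \<noteq> 0"
    and q: "\<And>c p. c \<in> A \<Longrightarrow> p \<in> fst c \<Longrightarrow> p \<in> u_dom \<Longrightarrow> poly q (u p) * \<omega> (c, snd c p) = 0"
  shows "q = 0"
proof (rule ccontr)
  assume "q \<noteq> 0"
  obtain c U where U: "c \<in> A" "open U" "U \<noteq> {}" "U \<subseteq> snd c ` (fst c \<inter> u_dom)"
    "\<And>t. t \<in> U \<Longrightarrow> \<omega> (c, t) \<noteq> 0" using generic_open_set[OF \<omega>] by metis
  have "(\<lambda>t. u (chart_inv c t)) ` U \<subseteq> {y. poly q y = 0}"
  proof clarify
    fix t assume t: "t \<in> U"
    then obtain p where "p \<in> fst c" "p \<in> u_dom" "t = snd c p" using U(4) by blast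
    then show "poly q (u (chart_inv c t)) = 0" using q[OF U(1)] U(5)[OF t] chart_inv_coord[OF U(1)] by auto
  qed
  then show False
    using poly_roots_finite[OF \<open>q \<noteq> 0\<close>] infinite_image_u[OF U(1-4)] finite_subset by blast
qed

lemma power_multiples_independent:
  fixes I :: "nat set"
  assumes \<omega>: "\<omega> \<in> canonical_forms A" "\<omega> \<noteq> 0" and I: "finite I"
    and e: "\<And>i. i \<in> I \<Longrightarrow> power_multiple i \<omega> (e i)"
    and sum: "(\<Sum>i\<in>I. cscale (b i) (e i)) = 0" and j: "j \<in> I"
  shows "b j = 0"
proof -
  define q where "q = (\<Sum>i\<in>I. monom (b i) i)"
  have "q = 0"
  proof (rule poly_multiple_eq_0[OF \<omega>])
    fix c p assume cp: "c \<in> A" "p \<in> fst c" "p \<in> u_dom"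
    have "poly q (u p) * \<omega> (c, snd c p) = (\<Sum>i\<in>I. b i * (u p ^ i * \<omega> (c, snd c p)))"
      by (simp add: q_def poly_sum poly_monom sum_distrib_right mult.assoc)
    also have "\<dots> = (\<Sum>i\<in>I. b i * e i (c, snd c p))"
      using power_multiple_apply[OF e cp] by (intro sum.cong) auto
    also have "\<dots> = (\<Sum>i\<in>I. cscale (b i) (e i)) (c, snd c p)"
      by (simp add: sum_fun_apply cscale_apply)
    finally show "poly q (u p) * \<omega> (c, snd c p) = 0" by (simp add: sum)
  qed
  then have "coeff q j = 0" by simp
  moreover have "coeff q j = (\<Sum>i\<in>I. if i = j then b i else 0)"
    by (simp add: q_def coeff_sum)
  ultimately show ?thesis using I j by simp
qed

lemma ex_power_multiple_Suc:
  assumes c: "c \<in> A" "p1 \<in> fst c" and \<eta>: "power_multiple m \<omega> \<eta>" "\<eta> (c, snd c p1) = 0"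
  shows "\<exists>\<theta>. power_multiple (Suc m) \<omega> \<theta>"
proof -
  have "\<exists>\<theta>\<in>canonical_forms A. \<forall>d\<in>A. \<forall>p\<in>fst d \<inter> u_dom. \<theta> (d, snd d p) = u p * \<eta> (d, snd d p)"
    by (rule ex_form_times_u) (use \<eta> vanishes_at_both_poles[OF _ c] power_multiple_form in auto)
  then show ?thesis using \<eta>(1) by (fastforce simp: power_multiple_def)
qed

text \<open>
  A linear system on the projective line is complete, in elementary terms: start from a form \<open>\<omega>\<close> that
  can be multiplied by the largest possible number \<open>n\<close> of factors \<open>u\<close>.  Independence bounds \<open>n\<close> by \<open>g\<close>,
  and maximality makes the multiples \<open>e i = u\<^sup>i \<omega>\<close> span.
\<close>

theorem canonical_forms_basis:
  assumes g: "cfun.dim (canonical_forms A) = g" "0 < g"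
  obtains \<omega> e where "\<omega> \<in> canonical_forms A" "\<omega> \<noteq> 0" "\<And>i. i < g \<Longrightarrow> power_multiple i \<omega> (e i)"
    "canonical_forms A = cfun.span (e ` {..<g})"
proof -
  let ?V = "canonical_forms A"
  obtain B where B: "B \<subseteq> ?V" "cfun.independent B" "?V \<subseteq> cfun.span B" "card B = g"
    using cfun.basis_exists[of ?V] g(1) by metis
  have finB: "finite B" using B(4) g(2) card_ge_0_finite by blast
  obtain c where c: "c \<in> A" "p1 \<in> fst c" using pole_x[of p1] by (auto elim: obtain_chart)
  define M where "M = (\<lambda>n. \<exists>\<omega>\<in>?V. \<omega> \<noteq> 0 \<and> (\<forall>i\<le>n. \<exists>\<eta>. power_multiple i \<omega> \<eta>))"
  have bound: "n < g" if Mn: "M n" for n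
  proof -
    obtain \<omega> where \<omega>: "\<omega> \<in> ?V" "\<omega> \<noteq> 0" "\<forall>i\<le>n. \<exists>\<eta>. power_multiple i \<omega> \<eta>"
      using Mn unfolding M_def by blast
    then obtain e where e: "\<And>i. i \<le> n \<Longrightarrow> power_multiple i \<omega> (e i)" by metis
    have ind: "inj_on e {..n}" "cfun.independent (e ` {..n})"
      by (rule cfun_independent_family; use power_multiples_independent[OF \<omega>(1,2), of "{..n}" e] e in auto)+
    have "e ` {..n} \<subseteq> cfun.span B" using e B(3) power_multiple_form by blast
    from cfun.independent_span_bound[OF finB ind(2) this] show ?thesis
      using ind(1) B(4) by (simp add: card_image)
  qed
  have "\<exists>\<omega>\<in>?V. \<omega> \<noteq> 0"
  proof (rule ccontr)
    assume "\<not> ?thesis"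
    then have "B \<subseteq> {0}" using B(1) by blast
    then have "B = {}" using B(2) cfun.dependent_zero by blast
    then show False using B(4) g(2) by simp
  qed
  then have "M 0" using power_multiple_0 unfolding M_def by blast
  then obtain n where n: "M n" "\<And>m. M m \<Longrightarrow> m \<le> n"
    using GreatestI_nat[of M 0 g] Greatest_le_nat[of M _ g] bound less_imp_le by metis
  then obtain \<omega> where \<omega>: "\<omega> \<in> ?V" "\<omega> \<noteq> 0" "\<forall>i\<le>n. \<exists>\<eta>. power_multiple i \<omega> \<eta>"
    unfolding M_def by blast
  then obtain e where e: "\<And>i. i \<le> n \<Longrightarrow> power_multiple i \<omega> (e i)" by metis
  \<comment> \<open>Otherwise \<open>\<omega>\<close> could be multiplied by one more factor \<open>u\<close>.\<close>
  have en: "e n (c, snd c p1) \<noteq> 0"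
  proof
    assume "e n (c, snd c p1) = 0"
    from ex_power_multiple_Suc[OF c e[OF order_refl] this] have "M (Suc n)"
      unfolding M_def using \<omega> by (metis le_Suc_eq)
    with n(2) show False by fastforce
  qed
  \<comment> \<open>After \<open>m\<close> corrections, \<open>\<eta> - \<zeta>\<close> remains holomorphic when multiplied by \<open>u\<close> up to \<open>m\<close> times.\<close>
  have step: "\<exists>\<zeta>\<in>cfun.span (e ` {..n}). \<forall>i\<le>m. \<exists>\<theta>. power_multiple i (\<eta> - \<zeta>) \<theta>"
    if \<eta>: "\<eta> \<in> ?V" and "m \<le> Suc n" for \<eta> m
    using that(2)
  proof (induction m)
    case 0
    have "power_multiple 0 (\<eta> - 0) \<eta>" using power_multiple_0[OF \<eta>] by simp
    then show ?case using cfun.span_zero by (metis le_zero_eq)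
  next
    case (Suc m)
    then obtain \<zeta> where \<zeta>: "\<zeta> \<in> cfun.span (e ` {..n})" "\<forall>i\<le>m. \<exists>\<theta>. power_multiple i (\<eta> - \<zeta>) \<theta>"
      using Suc_leD by blast
    then obtain f where f: "\<And>i. i \<le> m \<Longrightarrow> power_multiple i (\<eta> - \<zeta>) (f i)" by metis
    \<comment> \<open>Chosen so that \<open>u\<^sup>m (\<eta> - \<zeta>) - b u\<^sup>n \<omega>\<close> vanishes at \<open>p1\<close>, where \<open>u\<^sup>n \<omega>\<close> does not.\<close>
    define b where "b = f m (c, snd c p1) / e n (c, snd c p1)"
    define \<zeta>' where "\<zeta>' = \<zeta> + cscale b (e (n - m))"
    have \<zeta>'_span: "\<zeta>' \<in> cfun.span (e ` {..n})"
      unfolding \<zeta>'_def by (intro cfun.span_add \<zeta> cfun.span_scale cfun.span_base) auto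
    have low: "power_multiple i (\<eta> - \<zeta>') (f i - cscale b (e (n - m + i)))" if "i \<le> m" for i
    proof -
      have 1: "power_multiple (n - m + i) \<omega> (e (n - m + i))" using that Suc.prems by (intro e) auto
      have 2: "power_multiple (n - m) \<omega> (e (n - m))" by (rule e) simp
      have "power_multiple i (e (n - m)) (e (n - m + i))"
        using 1 2 by (simp add: power_multiple_def power_add mult_ac)
      from power_multiple_diff[OF f[OF that] this, of b] show ?thesis
        by (simp add: \<zeta>'_def algebra_simps)
    qed
    have "(f m - cscale b (e (n - m + m))) (c, snd c p1) = 0"
      using en Suc.prems by (simp add: b_def cscale_apply)
    from ex_power_multiple_Suc[OF c low[OF order_refl] this] low
    have "\<forall>i\<le>Suc m. \<exists>\<theta>. power_multiple i (\<eta> - \<zeta>') \<theta>" by (metis le_Suc_eq)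
    with \<zeta>'_span show ?case by blast
  qed
  have "?V \<subseteq> cfun.span (e ` {..n})"
  proof
    fix \<eta> assume \<eta>: "\<eta> \<in> ?V"
    obtain \<zeta> where \<zeta>: "\<zeta> \<in> cfun.span (e ` {..n})" "\<forall>i\<le>Suc n. \<exists>\<theta>. power_multiple i (\<eta> - \<zeta>) \<theta>"
      using step[OF \<eta>, of "Suc n"] by blast
    have "cfun.span (e ` {..n}) \<subseteq> ?V"
      by (rule cfun.span_minimal[OF _ subspace_canonical_forms]) (use e power_multiple_form in blast)
    then have "\<eta> - \<zeta> \<in> ?V" using \<zeta>(1) \<eta> cfun.subspace_diff[OF subspace_canonical_forms] by blast
    moreover have "\<not> M (Suc n)" using n(2)[of "Suc n"] by auto
    ultimately have "\<eta> - \<zeta> = 0" unfolding M_def using \<zeta>(2) by blast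
    then show "\<eta> \<in> cfun.span (e ` {..n})" using \<zeta>(1) by simp
  qed
  moreover have "cfun.span (e ` {..n}) \<subseteq> ?V"
    by (rule cfun.span_minimal[OF _ subspace_canonical_forms]) (use e power_multiple_form in blast)
  ultimately have V: "?V = cfun.span (e ` {..n})" by blast
  moreover have "cfun.dim (cfun.span (e ` {..n})) = Suc n"
  proof -
    have "cfun.dim (cfun.span (e ` {..n})) = card {..n}"
    proof (rule cfun_dim_span_family)
      show "b i = 0" if "(\<Sum>i\<le>n. cscale (b i) (e i)) = 0" "i \<in> {..n}" for b i
        by (rule power_multiples_independent[OF \<omega>(1,2) finite_atMost _ that]) (simp add: e)
    qed simp
    then show ?thesis by simp
  qed
  ultimately have "g = Suc n" using g(1) by simp
  then show thesis using that[of \<omega> e] \<omega>(1,2) e V by (auto simp: lessThan_Suc_atMost less_Suc_eq_le)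
qed

end

section \<open>Symmetric polynomials and their order along the diagonal\<close>

text \<open>
  Symmetric polynomials of degree at most \<open>n\<close> in each variable, generated as combinations of squares
  \<open>q(x) q(y)\<close>.  In this form they correspond to combinations of tensor squares of forms, and products
  of two such squares are again squares.
\<close>

inductive sympoly :: "nat \<Rightarrow> (complex \<Rightarrow> complex \<Rightarrow> complex) \<Rightarrow> bool" for n where
  square: "degree q \<le> n \<Longrightarrow> sympoly n (\<lambda>x y. b * (poly q x * poly q y))"
| add: "sympoly n P \<Longrightarrow> sympoly n R \<Longrightarrow> sympoly n (\<lambda>x y. P x y + R x y)"

lemma sympoly_mono: "sympoly m P \<Longrightarrow> m \<le> n \<Longrightarrow> sympoly n P"
  by (induction rule: sympoly.induct) (auto intro: sympoly.intros)

lemma sympoly_mult_square: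
  assumes "sympoly n R" "degree q \<le> m"
  shows "sympoly (m + n) (\<lambda>x y. (b * (poly q x * poly q y)) * R x y)"
  using assms(1)
proof (induction rule: sympoly.induct)
  case (square r b')
  have "degree (q * r) \<le> m + n" using degree_mult_le[of q r] assms(2) square by simp
  from sympoly.square[OF this, of "b * b'"] show ?case by (simp add: mult_ac)
next
  case (add P R)
  then show ?case using sympoly.add[OF add.IH] by (simp add: distrib_left)
qed

lemma sympoly_mult:
  assumes "sympoly m P" "sympoly n R"
  shows "sympoly (m + n) (\<lambda>x y. P x y * R x y)"
  using assms(1)
proof (induction rule: sympoly.induct)
  case (square q b)
  then show ?case by (rule sympoly_mult_square[OF assms(2)])
next
  case (add P P')
  then show ?case using sympoly.add[OF add.IH] by (simp add: distrib_right)
qed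

lemma sympoly_1: "sympoly 0 (\<lambda>x y. 1)"
  using sympoly.square[of 1 0 1] by simp

lemma sympoly_power:
  assumes "sympoly m P" shows "sympoly (l * m) (\<lambda>x y. P x y ^ l)"
proof (induction l)
  case 0
  show ?case using sympoly_1 by simp
next
  case (Suc l)
  then show ?case using sympoly_mult[OF assms Suc] by simp
qed

text \<open>
  From \<open>x\<^sup>2 + y\<^sup>2 = (1 + x\<^sup>2)(1 + y\<^sup>2) - 1 - x\<^sup>2 y\<^sup>2\<close>.
\<close>

lemma sympoly_diff_square: "sympoly 2 (\<lambda>x y. (x - y)\<^sup>2)"
proof -
  have "sympoly 2 (\<lambda>x y. ((1 * (poly [:1, 0, 1:] x * poly [:1, 0, 1:] y)
      + (-1) * (poly 1 x * poly 1 y)) + (-1) * (poly [:0, 0, 1:] x * poly [:0, 0, 1:] y))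
      + (-2) * (poly [:0, 1:] x * poly [:0, 1:] y))"
    by (intro sympoly.intros) auto
  then show ?thesis by (simp add: algebra_simps power2_eq_square)
qed

text \<open>
  From \<open>x + y = (1 + x)(1 + y) - 1 - x y\<close>.
\<close>

lemma sympoly_sum: "sympoly 1 (\<lambda>x y. (x + y) / 2)"
proof -
  have "sympoly 1 (\<lambda>x y. ((1/2) * (poly [:1, 1:] x * poly [:1, 1:] y)
      + (-1/2) * (poly 1 x * poly 1 y)) + (-1/2) * (poly [:0, 1:] x * poly [:0, 1:] y))"
    by (intro sympoly.intros) auto
  moreover have "(\<lambda>x y. ((1/2) * (poly [:1, 1:] x * poly [:1, 1:] y)
      + (-1/2) * (poly 1 x * poly 1 y)) + (-1/2) * (poly [:0, 1:] x * poly [:0, 1:] y)) =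
      (\<lambda>x y :: complex. (x + y) / 2)"
    by (simp add: fun_eq_iff field_simps)
  ultimately show ?thesis by simp
qed

text \<open>
  A symmetric polynomial that restricts to \<open>x\<^sup>s\<close> on the diagonal and has the smallest possible degree
  \<open>\<lceil>s/2\<rceil>\<close> in each variable.
\<close>

definition diag_power :: "nat \<Rightarrow> complex \<Rightarrow> complex \<Rightarrow> complex" where
  "diag_power s x y = (x * y) ^ (s div 2) * ((x + y) / 2) ^ (s mod 2)"

lemma diag_power_same: "diag_power s x x = x ^ s"
proof -
  have "diag_power s x x = x ^ (2 * (s div 2) + s mod 2)"
    by (simp only: power_add power_mult) (simp add: diag_power_def power2_eq_square)
  then show ?thesis by simp
qed

lemma sympoly_diag_power: "sympoly (s div 2 + s mod 2) (diag_power s)"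
proof -
  have "sympoly 1 (\<lambda>x y. 1 * (poly [:0, 1:] x * poly [:0, 1:] y))"
    by (rule sympoly.square) simp
  then have "sympoly 1 (\<lambda>x y. x * y)" by simp
  from sympoly_mult[OF sympoly_power[OF this, of "s div 2"] sympoly_power[OF sympoly_sum, of "s mod 2"]]
  show ?thesis by (simp add: diag_power_def[abs_def])
qed

text \<open>
  The pair \<open>(l, s)\<close> stands for the polynomial \<open>(x - y)\<^sup>2\<^sup>l diag_power s x y\<close>; the bounds say that its
  degree in each variable is at most \<open>n\<close>.
\<close>

definition strata :: "nat \<Rightarrow> (nat \<times> nat) set" where
  "strata n = {(l, s). 2 * l \<le> n \<and> s \<le> 2 * (n - 2 * l)}"

lemma sympoly_stratum:
  assumes "(l, s) \<in> strata n"
  shows "sympoly n (\<lambda>x y. (x - y) ^ (2 * l) * diag_power s x y)"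
proof -
  have "sympoly (l * 2 + (s div 2 + s mod 2)) (\<lambda>x y. ((x - y)\<^sup>2) ^ l * diag_power s x y)"
    by (intro sympoly_mult sympoly_power sympoly_diff_square sympoly_diag_power)
  moreover have "l * 2 + (s div 2 + s mod 2) \<le> n"
    using assms unfolding strata_def by simp presburger
  ultimately show ?thesis
    using sympoly_mono by (fastforce simp: power_mult)
qed

lemma strata_ge: "{i \<in> strata n. k \<le> fst i} = (SIGMA l:{k..n div 2}. {..2 * (n - 2 * l)})"
  by (auto simp: strata_def)

lemma strata_eq: "{i \<in> strata n. fst i = k} = (if 2 * k \<le> n then {k} \<times> {..2 * (n - 2 * k)} else {})"
  by (auto simp: strata_def)

lemma finite_strata: "finite (strata n)"
  using strata_ge[of n 0] finite_SigmaI[of "{0..n div 2}" "\<lambda>l. {..2 * (n - 2 * l)}"] by simp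

lemma card_strata_eq: "card {i \<in> strata n. fst i = k} = (if 2 * k \<le> n then 2 * (n - 2 * k) + 1 else 0)"
  unfolding strata_eq by (simp add: card_cartesian_product)

text \<open>
  With \<open>m = n - 2k\<close>, the number of strata of level at least \<open>k\<close> is \<open>(m + 1)(m + 2)/2\<close>: passing from \<open>k\<close> to
  \<open>k + 1\<close> removes \<open>2m + 1\<close> pairs and lowers \<open>m\<close> by \<open>2\<close>.
\<close>

lemma card_strata_ge:
  assumes "2 * k \<le> n"
  shows "2 * card {i \<in> strata n. k \<le> fst i} = (n - 2 * k + 1) * (n - 2 * k + 2)"
  using assms
proof (induction "n - 2 * k" arbitrary: k rule: less_induct)
  case less
  have split: "{i \<in> strata n. k \<le> fst i} = {i \<in> strata n. fst i = k} \<union> {i \<in> strata n. Suc k \<le> fst i}"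
    by auto
  have card: "card {i \<in> strata n. k \<le> fst i} = (2 * (n - 2 * k) + 1) + card {i \<in> strata n. Suc k \<le> fst i}"
    unfolding split using finite_strata less.prems
    by (subst card_Un_disjoint) (auto simp: card_strata_eq)
  show ?case
  proof (cases "2 * Suc k \<le> n")
    case True
    then obtain m where m: "n = 2 * Suc k + m" using le_Suc_ex by blast
    have "2 * card {i \<in> strata n. Suc k \<le> fst i} = (n - 2 * Suc k + 1) * (n - 2 * Suc k + 2)"
      by (rule less.hyps) (use True in auto)
    then show ?thesis unfolding card by (simp add: m algebra_simps)
  next
    case False
    then have "{i \<in> strata n. Suc k \<le> fst i} = {}" by (auto simp: strata_def)
    then have "card {i \<in> strata n. Suc k \<le> fst i} = 0" by (simp only: card.empty)
    moreover have "n = 2 * k \<or> n = 2 * k + 1" using False less.prems by auto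
    ultimately show ?thesis unfolding card by auto
  qed
qed

section \<open>Rank and kernel of the even Gaussian maps\<close>

context riemann_surface
begin

lemma sym_square_holomorphic:
  assumes Q: "Q \<in> sym_square (canonical_forms A)" and c: "c \<in> A"
  shows "(\<lambda>t. Q ((c, t), v)) holomorphic_on chart_image c"
proof -
  obtain N :: nat and a \<eta> where \<eta>: "\<And>i. i < N \<Longrightarrow> \<eta> i \<in> canonical_forms A"
      and Q': "Q = (\<lambda>(u, v). \<Sum>i<N. \<Sum>j<N. a i j * \<eta> i u * \<eta> j v)"
    using Q unfolding sym_square_def by blast
  show ?thesis
    unfolding Q' using form_holomorphic[OF \<eta> c] by (auto intro!: holomorphic_intros)
qed

lemma sym_square_outside:
  assumes Q: "Q \<in> sym_square (canonical_forms A)" and "c \<notin> A \<or> z \<notin> chart_image c"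
  shows "Q (v, (c, z)) = 0"
proof -
  obtain N :: nat and a \<eta> where \<eta>: "\<And>i. i < N \<Longrightarrow> \<eta> i \<in> canonical_forms A"
      and Q': "Q = (\<lambda>(u, v). \<Sum>i<N. \<Sum>j<N. a i j * \<eta> i u * \<eta> j v)"
    using Q unfolding sym_square_def by blast
  show ?thesis
    unfolding Q' using form_outside[OF \<eta> assms(2)] by simp
qed

lemma gauss_map_outside:
  assumes Q: "Q \<in> sym_square (canonical_forms A)" and "c \<notin> A \<or> z \<notin> chart_image c"
  shows "gauss_map k Q (c, z) = 0"
  using sym_square_outside[OF assms] by (simp add: gauss_map_def higher_deriv_const)

text \<open>
  By the tensor formula the value is a holomorphic expression in the point of the diagonal; from the
  definition alone, which also moves the function being differentiated, this is not apparent.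
\<close>

lemma continuous_gauss_map:
  assumes Q: "Q \<in> sym_square (canonical_forms A)" and c: "c \<in> A"
  shows "continuous_on (chart_image c) (\<lambda>z. gauss_map k Q (c, z))"
proof -
  obtain N :: nat and a \<eta> where \<eta>: "\<And>i. i < N \<Longrightarrow> \<eta> i \<in> canonical_forms A"
      and Q': "Q = (\<lambda>(u, v). \<Sum>i<N. \<Sum>j<N. a i j * \<eta> i u * \<eta> j v)"
    using Q unfolding sym_square_def by blast
  have "(\<lambda>z. \<Sum>i<N. \<Sum>j<N. a i j * (deriv ^^ (2 * k)) (\<lambda>t. \<eta> i (c, t)) z * \<eta> j (c, z))
      holomorphic_on chart_image c"
    using form_holomorphic[OF \<eta> c] open_chart_image[OF c]
    by (intro holomorphic_intros holomorphic_higher_deriv) auto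
  then have "continuous_on (chart_image c)
      (\<lambda>z. \<Sum>i<N. \<Sum>j<N. a i j * (deriv ^^ (2 * k)) (\<lambda>t. \<eta> i (c, t)) z * \<eta> j (c, z))"
    by (rule holomorphic_on_imp_continuous_on)
  then show ?thesis
    unfolding Q' using gauss_map_tensor[OF \<eta> c chart[OF c]] by (simp cong: continuous_on_cong)
qed

lemma gauss_map_add:
  assumes Q: "Q \<in> sym_square (canonical_forms A)" and R: "R \<in> sym_square (canonical_forms A)"
  shows "gauss_map k (Q + R) = gauss_map k Q + gauss_map k R"
proof
  fix cz :: "'a chart \<times> complex"
  obtain c z where cz: "cz = (c, z)" by (cases cz)
  show "gauss_map k (Q + R) cz = (gauss_map k Q + gauss_map k R) cz"
  proof (cases "c \<in> A \<and> z \<in> chart_image c")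
    case True
    then have c: "c \<in> A" and z: "z \<in> chart_image c" by auto
    have "(deriv ^^ (2 * k)) (\<lambda>t. Q ((c, t), (c, z)) + R ((c, t), (c, z))) z =
        (deriv ^^ (2 * k)) (\<lambda>t. Q ((c, t), (c, z))) z + (deriv ^^ (2 * k)) (\<lambda>t. R ((c, t), (c, z))) z"
      by (rule higher_deriv_add[OF sym_square_holomorphic[OF Q c] sym_square_holomorphic[OF R c] open_chart_image[OF c] z])
    then show ?thesis by (simp add: cz gauss_map_def)
  next
    case False
    then have "c \<notin> A \<or> z \<notin> chart_image c" by blast
    then show ?thesis
      using sym_square_outside[OF Q] sym_square_outside[OF R]
      by (simp add: cz gauss_map_def higher_deriv_const)
  qed
qed

lemma gauss_map_cscale:
  assumes Q: "Q \<in> sym_square (canonical_forms A)"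
  shows "gauss_map k (cscale b Q) = cscale b (gauss_map k Q)"
proof
  fix cz :: "'a chart \<times> complex"
  obtain c z where cz: "cz = (c, z)" by (cases cz)
  show "gauss_map k (cscale b Q) cz = cscale b (gauss_map k Q) cz"
  proof (cases "c \<in> A \<and> z \<in> chart_image c")
    case True
    then have c: "c \<in> A" and z: "z \<in> chart_image c" by auto
    have "(deriv ^^ (2 * k)) (\<lambda>t. b * Q ((c, t), (c, z))) z = b * (deriv ^^ (2 * k)) (\<lambda>t. Q ((c, t), (c, z))) z"
      by (rule higher_deriv_cmult[OF sym_square_holomorphic[OF Q c] z open_chart_image[OF c]])
    then show ?thesis by (simp add: cz gauss_map_def cscale_apply)
  next
    case False
    then have "c \<notin> A \<or> z \<notin> chart_image c" by blast
    then show ?thesis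
      using sym_square_outside[OF Q] by (simp add: cz gauss_map_def higher_deriv_const cscale_apply)
  qed
qed

end

context unramified_value
begin

lemma gauss_map_eq_0:
  assumes Q: "Q \<in> sym_square (canonical_forms A)"
    and zero: "\<And>c p. c \<in> A \<Longrightarrow> p \<in> fst c \<Longrightarrow> p \<in> u_dom \<Longrightarrow> gauss_map k Q (c, snd c p) = 0"
  shows "gauss_map k Q = 0"
proof
  fix cz :: "'a chart \<times> complex"
  obtain c z where cz: "cz = (c, z)" by (cases cz)
  show "gauss_map k Q cz = 0 cz"
  proof (cases "c \<in> A \<and> z \<in> chart_image c")
    case True
    then have c: "c \<in> A" "z \<in> chart_image c" by auto
    have "continuous_on (chart_image c) (\<lambda>z. 0 :: complex)" by simp
    from eq_off_poles[OF c(1) continuous_gauss_map[OF Q c(1)] this zero[OF c(1)] c(2)]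
    show ?thesis by (simp add: cz)
  next
    case False
    then show ?thesis using gauss_map_outside[OF Q] by (auto simp: cz)
  qed
qed

text \<open>
  \<open>Q = P(u p, u q) \<omega>(p) \<omega>(q)\<close>, read with both points in the same chart, off the poles of \<open>u\<close>.
\<close>

definition represents ::
  "('a chart \<times> complex \<Rightarrow> complex) \<Rightarrow> (complex \<Rightarrow> complex \<Rightarrow> complex) \<Rightarrow>
    (('a chart \<times> complex) \<times> ('a chart \<times> complex) \<Rightarrow> complex) \<Rightarrow> bool" where
  "represents \<omega> P Q \<longleftrightarrow> Q \<in> sym_square (canonical_forms A) \<and>
     (\<forall>c\<in>A. \<forall>p\<in>fst c \<inter> u_dom. \<forall>q\<in>fst c \<inter> u_dom.
        Q ((c, snd c p), (c, snd c q)) = P (u p) (u q) * \<omega> (c, snd c p) * \<omega> (c, snd c q))"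

lemma ex_poly_multiple:
  assumes e: "\<And>i. i < g \<Longrightarrow> power_multiple i \<omega> (e i)" and q: "degree q < g"
  shows "\<exists>\<eta>\<in>canonical_forms A. \<forall>c\<in>A. \<forall>p\<in>fst c \<inter> u_dom. \<eta> (c, snd c p) = poly q (u p) * \<omega> (c, snd c p)"
proof (intro bexI ballI)
  let ?\<eta> = "\<Sum>i<g. cscale (coeff q i) (e i)"
  show "?\<eta> \<in> canonical_forms A"
    by (intro cfun.subspace_sum[OF subspace_canonical_forms] cfun.subspace_scale[OF subspace_canonical_forms])
      (use e power_multiple_form in blast)
  fix c p assume c: "c \<in> A" "p \<in> fst c \<inter> u_dom"
  have "poly q y = (\<Sum>i<g. coeff q i * y ^ i)" for y
    unfolding poly_altdef using q by (intro sum.mono_neutral_left) (auto simp: coeff_eq_0)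
  moreover have "?\<eta> (c, snd c p) = (\<Sum>i<g. coeff q i * (u p ^ i * \<omega> (c, snd c p)))"
    using c power_multiple_apply[OF e] by (simp add: sum_fun_apply cscale_apply)
  ultimately show "?\<eta> (c, snd c p) = poly q (u p) * \<omega> (c, snd c p)"
    by (simp add: sum_distrib_right mult.assoc)
qed

lemma ex_represents:
  assumes e: "\<And>i. i < g \<Longrightarrow> power_multiple i \<omega> (e i)" and g: "0 < g"
    and P: "sympoly (g - 1) P"
  shows "\<exists>Q. represents \<omega> P Q"
  using P
proof (induction rule: sympoly.induct)
  case (square q b)
  then have "degree q < g" using g by simp
  from ex_poly_multiple[OF e this] obtain \<eta> where \<eta>: "\<eta> \<in> canonical_forms A"
    "\<And>c p. c \<in> A \<Longrightarrow> p \<in> fst c \<inter> u_dom \<Longrightarrow> \<eta> (c, snd c p) = poly q (u p) * \<omega> (c, snd c p)" by blast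
  have "represents \<omega> (\<lambda>x y. b * (poly q x * poly q y)) (cscale b (tensor_square \<eta>))"
    unfolding represents_def sym_square_eq_span[OF subspace_canonical_forms]
    using \<eta> by (auto intro: cfun.span_scale cfun.span_base simp: cscale_apply)
  then show ?case by blast
next
  case (add P R)
  then obtain Q Q' where "represents \<omega> P Q" "represents \<omega> R Q'" by blast
  then have "represents \<omega> (\<lambda>x y. P x y + R x y) (Q + Q')"
    unfolding represents_def sym_square_eq_span[OF subspace_canonical_forms]
    by (auto intro: cfun.span_add simp: distrib_right)
  then show ?case by blast
qed

text \<open>
  In the first variable the tensor is \<open>(u t - u z)\<^sup>2\<^sup>l\<close> times a holomorphic function, so that its
  derivatives at \<open>t = z\<close> of order below \<open>2l\<close> vanish and the one of order \<open>2l\<close> is the leading coefficient.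
\<close>

lemma gauss_map_stratum:
  assumes \<omega>: "\<omega> \<in> canonical_forms A"
    and Q: "represents \<omega> (\<lambda>x y. (x - y) ^ (2 * l) * diag_power s x y) Q"
    and c: "c \<in> A" "p \<in> fst c" "p \<in> u_dom"
  shows "k < l \<Longrightarrow> gauss_map k Q (c, snd c p) = 0"
    and "gauss_map l Q (c, snd c p) = u p ^ s *
      (fact (2 * l) * deriv (\<lambda>t. u (chart_inv c t)) (snd c p) ^ (2 * l) * (\<omega> (c, snd c p))\<^sup>2)"
proof -
  let ?S = "snd c ` (fst c \<inter> u_dom)" and ?z = "snd c p"
  define uc where "uc = (\<lambda>t. u (chart_inv c t))"
  define H where "H = (\<lambda>t. diag_power s (uc t) (uc ?z) * \<omega> (c, t) * \<omega> (c, ?z))"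
  have S: "open ?S" "?z \<in> ?S" using c open_coord_image[OF c(1) openin_u_dom] by auto
  have uc: "uc holomorphic_on ?S" unfolding uc_def by (rule u_holomorphic[OF c(1)])
  have "(\<lambda>t. \<omega> (c, t)) holomorphic_on ?S"
    by (rule holomorphic_on_subset[OF form_holomorphic[OF \<omega> c(1)]]) (auto simp: coord_in)
  then have H: "H holomorphic_on ?S"
    unfolding H_def diag_power_def by (intro holomorphic_intros uc) auto
  have eq: "(uc t - uc ?z) ^ (2 * l) * H t = Q ((c, t), (c, ?z))" if "t \<in> ?S" for t
    using that Q c by (auto simp: represents_def H_def uc_def chart_inv_coord mult_ac)
  have hol: "(\<lambda>t. (uc t - uc ?z) ^ (2 * l) * H t) holomorphic_on ?S"
    by (intro holomorphic_intros uc H)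
  have G: "gauss_map k Q (c, ?z) = (deriv ^^ (2 * k)) (\<lambda>t. (uc t - uc ?z) ^ (2 * l) * H t) ?z" for k
    unfolding gauss_map_def prod.case
    by (rule higher_deriv_transform_within_open[OF _ hol S])
      (rule holomorphic_transform[OF hol eq], simp_all add: eq)
  show "gauss_map k Q (c, ?z) = 0" if "k < l"
    unfolding G by (rule higher_deriv_power_mult_less[OF S uc H]) (use that in simp)
  show "gauss_map l Q (c, ?z) = u p ^ s *
      (fact (2 * l) * deriv (\<lambda>t. u (chart_inv c t)) ?z ^ (2 * l) * (\<omega> (c, ?z))\<^sup>2)"
    unfolding G higher_deriv_power_mult[OF S uc H]
    using c by (simp add: H_def diag_power_same uc_def chart_inv_coord power2_eq_square)
qed

text \<open>
  The tensors of the strata satisfy the hypotheses of \<open>kernel_filtration\<close>.  On level \<open>k\<close> the images under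
  the Gaussian map are the functions \<open>u\<^sup>s\<close> times one fixed factor that is not identically \<open>0\<close>, hence
  independent; and the number of strata is \<open>g(g+1)/2\<close>, the bound for the dimension of the symmetric
  square.
\<close>

theorem gauss_filtration:
  assumes g: "cfun.dim (canonical_forms A) = g" "0 < g"
  obtains Q where "\<And>k. gauss_dom A k = cfun.span (Q ` {i \<in> strata (g - 1). k \<le> fst i})"
    and "\<And>k. cfun.dim (gauss_dom A k) = card {i \<in> strata (g - 1). k \<le> fst i}"
    and "\<And>k. gauss_rank A k = card {i \<in> strata (g - 1). fst i = k}"
proof -
  let ?D = "sym_square (canonical_forms A)" and ?I = "strata (g - 1)"
  obtain \<omega> e where \<omega>: "\<omega> \<in> canonical_forms A" and \<omega>0: "\<omega> \<noteq> 0" and e: "\<And>i. i < g \<Longrightarrow> power_multiple i \<omega> (e i)"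
    and V: "canonical_forms A = cfun.span (e ` {..<g})"
    using canonical_forms_basis[OF g] by metis
  have "\<forall>i\<in>?I. \<exists>Q. represents \<omega> (\<lambda>x y. (x - y) ^ (2 * fst i) * diag_power (snd i) x y) Q"
    using ex_represents[OF e g(2)] sympoly_stratum by simp
  from bchoice[OF this] obtain Q
    where Q: "\<And>i. i \<in> ?I \<Longrightarrow> represents \<omega> (\<lambda>x y. (x - y) ^ (2 * fst i) * diag_power (snd i) x y) (Q i)"
    by blast
  have QD: "Q i \<in> ?D" if "i \<in> ?I" for i using Q[OF that] by (simp add: represents_def)
  have kill: "gauss_map k (Q i) = 0" if "i \<in> ?I" "k < fst i" for k i
    using gauss_map_stratum(1)[OF \<omega> Q] that by (intro gauss_map_eq_0 QD) auto
  have lead: "b j = 0"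
    if sum: "(\<Sum>i | i \<in> ?I \<and> fst i = k. cscale (b i) (gauss_map k (Q i))) = 0"
      and j: "j \<in> ?I" "fst j = k" for k b j
  proof -
    let ?J = "{i \<in> ?I. fst i = k}"
    define q where "q = (\<Sum>i\<in>?J. monom (b i) (snd i))"
    have "q = 0"
    proof (rule ccontr)
      assume "q \<noteq> 0"
      obtain c U where U: "c \<in> A" "open U" "U \<noteq> {}" "U \<subseteq> snd c ` (fst c \<inter> u_dom)"
        "\<And>t. t \<in> U \<Longrightarrow> \<omega> (c, t) \<noteq> 0" "\<And>t. t \<in> U \<Longrightarrow> deriv (\<lambda>t. u (chart_inv c t)) t \<noteq> 0"
        using generic_open_set[OF \<omega> \<omega>0] by metis
      have "poly q (u (chart_inv c t)) = 0" if t: "t \<in> U" for t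
      proof -
        obtain p where p: "p \<in> fst c" "p \<in> u_dom" "t = snd c p" using U(4) t by blast
        \<comment> \<open>The factor common to all tensors of level \<open>k\<close>.\<close>
        define C where "C = fact (2 * k) * deriv (\<lambda>t. u (chart_inv c t)) t ^ (2 * k) * (\<omega> (c, t))\<^sup>2"
        have "C \<noteq> 0" using U(5,6)[OF t] by (simp add: C_def)
        have "0 = (\<Sum>i\<in>?J. cscale (b i) (gauss_map k (Q i))) (c, t)" by (simp only: sum zero_fun_apply)
        also have "\<dots> = (\<Sum>i\<in>?J. b i * (u p ^ snd i * C))"
          unfolding sum_fun_apply
        proof (rule sum.cong[OF refl])
          fix i assume i: "i \<in> ?J"
          then have "gauss_map k (Q i) (c, t) = u p ^ snd i * C"
            using gauss_map_stratum(2)[OF \<omega> Q U(1) p(1,2), of i] by (auto simp: C_def p(3))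
          then show "cscale (b i) (gauss_map k (Q i)) (c, t) = b i * (u p ^ snd i * C)"
            by (simp add: cscale_apply)
        qed
        also have "\<dots> = poly q (u p) * C"
          by (simp add: q_def poly_sum poly_monom sum_distrib_right mult.assoc)
        finally show ?thesis using \<open>C \<noteq> 0\<close> p chart_inv_coord[OF U(1)] by simp
      qed
      then have "(\<lambda>t. u (chart_inv c t)) ` U \<subseteq> {y. poly q y = 0}" by blast
      then show False
        using poly_roots_finite[OF \<open>q \<noteq> 0\<close>] infinite_image_u[OF U(1-4)] finite_subset by blast
    qed
    then have "0 = coeff q (snd j)" by simp
    also have "\<dots> = (\<Sum>i\<in>?J. if i = j then b i else 0)"
      unfolding q_def coeff_sum
    proof (rule sum.cong[OF refl])
      fix i assume "i \<in> ?J"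
      then show "coeff (monom (b i) (snd i)) (snd j) = (if i = j then b i else 0)"
        using j by (auto simp: prod_eq_iff)
    qed
    also have "\<dots> = b j" using j finite_strata by simp
    finally show ?thesis by simp
  qed
  obtain T where T: "finite T" "card T \<le> g * (g + 1) div 2" "?D \<subseteq> cfun.span T"
    using sym_square_spanning_set[OF V] by metis
  have "2 * card ?I = g * (g + 1)"
    using card_strata_ge[of 0 "g - 1"] g(2) by simp
  then have cardT: "card T \<le> card ?I" using T(2) by simp
  have D0: "cfun.subspace ?D"
    unfolding sym_square_eq_span[OF subspace_canonical_forms] by (rule cfun.subspace_span)
  have DS: "gauss_dom A (Suc k) = {x \<in> gauss_dom A k. gauss_map k x = 0}" for k by simp
  have filtration: "gauss_dom A k = cfun.span (Q ` {i \<in> ?I. k \<le> fst i}) \<and>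
      cfun.dim (gauss_dom A k) = card {i \<in> ?I. k \<le> fst i} \<and>
      cfun.dim (gauss_map k ` gauss_dom A k) = card {i \<in> ?I. fst i = k}" for k
    by (intro conjI; rule kernel_filtration[where D = "gauss_dom A" and G = gauss_map and I = ?I and Q = Q and T = T];
        (unfold gauss_dom.simps(1))?;
        (rule D0 DS gauss_map_add gauss_map_cscale finite_strata QD kill T(1) cardT T(3) | erule lead);
        assumption)
  show thesis
  proof (rule that)
    show "gauss_dom A k = cfun.span (Q ` {i \<in> ?I. k \<le> fst i})" for k
      using filtration[of k] by blast
    show "cfun.dim (gauss_dom A k) = card {i \<in> ?I. k \<le> fst i}" for k
      using filtration[of k] by blast
    show "gauss_rank A k = card {i \<in> ?I. fst i = k}" for k
      unfolding gauss_rank_def using filtration[of k] by blast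
  qed
qed

end

theorem theorem1p1:
  fixes X :: "'a topology" and A :: "'a chart set" and g :: nat
  assumes "compact_riemann_surface X A"
    and "hyperelliptic X A"
    and "genus A = g"
    and "g \<ge> 3"
  shows "(\<forall>k::nat. real k \<le> (real g - 1) / 2 \<longrightarrow>
            int (gauss_rank A k) = 2 * int g - (4 * int k + 1) \<and>
            real (cfun.dim (gauss_ker A k)) =
              (real g - 1) * (real g - 2) / 2 - real k * (2 * real g - 2 * real k - 3)) \<and>
         (\<forall>k::nat. int k > \<lfloor>(real g - 1) / 2\<rfloor> \<longrightarrow>
            gauss_dom A k = {0} \<and> gauss_rank A k = 0)"
proof -
  obtain h where h: "holomorphic_map X A proj_line proj_line_atlas h"
      "has_degree X A proj_line proj_line_atlas h 2"
    using assms(2) by (auto simp: hyperelliptic_def)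
  interpret double_cover X A h
    by unfold_locales (use assms(1) h in \<open>auto simp: compact_riemann_surface_def\<close>)
  obtain a where a: "a \<notin> branch"
    using finite_branch ex_new_if_finite infinite_UNIV_char_0 by blast
  then obtain p1 p2 where p: "{p \<in> topspace X. h p = Some a} = {p1, p2}" "p1 \<noteq> p2"
    using card_fibre by (meson card_2_iff)
  interpret unramified_value X A h a p1 p2
    by unfold_locales (use a p in auto)
  have g: "cfun.dim (canonical_forms A) = g" "0 < g"
    using assms(3,4) by (auto simp: genus_def)
  obtain Q where dom: "\<And>k. gauss_dom A k = cfun.span (Q ` {i \<in> strata (g - 1). k \<le> fst i})"
    and dim: "\<And>k. cfun.dim (gauss_dom A k) = card {i \<in> strata (g - 1). k \<le> fst i}"
    and rank: "\<And>k. gauss_rank A k = card {i \<in> strata (g - 1). fst i = k}"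
    by (rule gauss_filtration[OF g]) (rule that)
  have ker: "gauss_ker A k = gauss_dom A (Suc k)" for k
    by (simp add: gauss_ker_def)
  show ?thesis
  proof (intro conjI allI impI)
    fix k :: nat assume "real k \<le> (real g - 1) / 2"
    then have "real (2 * k) \<le> real (g - 1)" using g(2) by (simp add: of_nat_diff)
    then have "2 * k \<le> g - 1" using of_nat_le_iff by blast
    \<comment> \<open>\<open>m = g - 1 - 2k\<close> bounds the degree of the cofactor of \<open>(x - y)\<^sup>2\<^sup>k\<close>.\<close>
    then obtain m where m: "g = 2 * k + m + 1" using g(2) by (metis Suc_eq_plus1 Suc_pred' le_Suc_ex)
    show "int (gauss_rank A k) = 2 * int g - (4 * int k + 1)"
      unfolding rank card_strata_eq by (simp add: m)
    have "2 * card {i \<in> strata (g - 1). Suc k \<le> fst i} = m * (m - 1)"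
    \<comment> \<open>For \<open>m < 2\<close> there is no stratum above level \<open>k\<close>, and \<open>m (m - 1) = 0\<close> as well.\<close>
    proof (cases "m < 2")
      case True
      then have "{i \<in> strata (g - 1). Suc k \<le> fst i} = {}" by (auto simp: strata_def m)
      then have empty: "card {i \<in> strata (g - 1). Suc k \<le> fst i} = 0" by (simp only: card.empty)
      show ?thesis unfolding empty using True by (auto simp: less_2_cases_iff)
    next
      case False
      then obtain j where "m = j + 2" using le_Suc_ex by (metis add.commute not_less)
      then show ?thesis using card_strata_ge[of "Suc k" "g - 1"] by (simp add: m)
    qed
    moreover have "2 * real N = real m * (real m - 1)" if "2 * N = m * (m - 1)" for N :: nat
    proof -
      have "2 * real N = real (m * (m - 1))" using that by (metis of_nat_mult of_nat_numeral)
      then show ?thesis by (cases m) (auto simp: algebra_simps)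
    qed
    ultimately have "2 * real (card {i \<in> strata (g - 1). Suc k \<le> fst i}) = real m * (real m - 1)"
      by blast
    then show "real (cfun.dim (gauss_ker A k)) =
        (real g - 1) * (real g - 2) / 2 - real k * (2 * real g - 2 * real k - 3)"
      unfolding ker dim by (simp add: m field_simps)
  next
    fix k :: nat assume "int k > \<lfloor>(real g - 1) / 2\<rfloor>"
    then have "real (g - 1) < real (2 * k)" using g(2) by (simp add: floor_less_iff of_nat_diff)
    then have "2 * k > g - 1" by (simp only: of_nat_less_iff)
    then have empty: "{i \<in> strata (g - 1). k \<le> fst i} = {}" "{i \<in> strata (g - 1). fst i = k} = {}"
      by (auto simp: strata_def)
    show "gauss_dom A k = {0}"
      unfolding dom empty image_empty by (rule cfun.span_empty)
    show "gauss_rank A k = 0"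
      unfolding rank empty by (rule card.empty)
  qed
qed

end
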